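(* Let $n,\ell\ge1$ be integers. At $q=\rho_\ell=e^{2\pi i/(2\ell+1)}$, the partition function $\mathcal Z_{n,\ell}(\bm x,\bm y)$ is a fully symmetric polynomial, i.e. it is symmetric in the whole set of $2n$ variables $x_1,\dots,x_n,y_1,\dots,y_n$.
   Context: Let $\bm x=(x_1,\dots,x_n)$, $\bm y=(y_1,\dots,y_n)$, and $\Delta(u_1,\dots,u_m)=\prod_{1\le i<j\le m}(u_i-u_j)$. Put $\bar{\bm x}=(x_1,q^2x_1,\dots,q^{2\ell-2}x_1,\dots,x_n,q^2x_n,\dots,q^{2\ell-2}x_n)$ and define $\bar{\bm y}$ similarly. The reduced partition function of the higher spin generalization of the 6-vertex model with domain wall boundary conditions is $$\mathcal Z_{n,\ell}(\bm x,\bm y)=\frac{\prod_{i,j=1}^n\prod_{p=0}^{\ell}\prod_{k=0}^{\ell-1}(q^{2k}x_i-q^{2p-1}y_j)}{\Delta(\bar{\bm x})\Delta(\bar{\bm y})}\det\mathcal A_\ell(\bm x,\bm y),$$ where $\mathcal A_\ell(\bm x,\bm y)=[A_\ell(x_\alpha,y_\beta)]_{\alpha,\beta=1}^n$ is the $\ell n\times\ell n$ block matrix with $\ell\times\ell$ blocks $$A_\ell(x,y)=\left[\frac{1}{(q^{2j}x-q^{2i-1}y)(q^{2j}x-q^{2i+1}y)}\right]_{i,j=0}^{\ell-1}.$$ This rational function is a polynomial in $\bm x,\bm y$. *)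

theory Defs
  imports
    Complex_Main
    "HOL-Library.Poly_Mapping"
    "HOL-Computational_Algebra.Polynomial_Factorial"
    "HOL-Combinatorics.Permutations"
    "Jordan_Normal_Form.Determinant"
begin

section \<open>Multivariate polynomials\<close>

text \<open>
  Polynomials in variables indexed by \<open>nat\<close>, as finitely supported functions from monomials
  (finitely supported exponent vectors) to coefficients. Over an integral domain they form an
  integral domain, and \<open>'a mpol fract\<close> is the field of rational functions.
\<close>

type_synonym 'a mpol = "(nat \<Rightarrow>\<^sub>0 nat) \<Rightarrow>\<^sub>0 'a"

definition mvar :: "nat \<Rightarrow> 'a::zero_neq_one mpol" where
  "mvar i = Poly_Mapping.single (Poly_Mapping.single i 1) 1"

definition mconst :: "'a::zero \<Rightarrow> 'a mpol" where
  "mconst c = Poly_Mapping.single 0 c"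

definition mvars :: "'a::zero mpol \<Rightarrow> nat set" where
  "mvars P = (\<Union>m\<in>Poly_Mapping.keys P. Poly_Mapping.keys m)"

text \<open>
  For a permutation \<open>\<pi>\<close>, this substitutes the variable with index \<open>\<pi> i\<close> for the one with
  index \<open>i\<close>; see \<open>mpermute_mvar\<close>. (\<open>map_key\<close> is only meaningful for injective maps.)
\<close>

definition mpermute :: "(nat \<Rightarrow> nat) \<Rightarrow> 'a::zero mpol \<Rightarrow> 'a mpol" where
  "mpermute \<pi> P = Poly_Mapping.map_key (Poly_Mapping.map_key \<pi>) P"

definition msymmetric :: "nat set \<Rightarrow> 'a::zero mpol \<Rightarrow> bool" where
  "msymmetric A P \<longleftrightarrow> (\<forall>\<pi>. \<pi> permutes A \<longrightarrow> mpermute \<pi> P = P)"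

lemma inj_map_key_permutes:
  assumes "\<pi> permutes A"
  shows "inj (Poly_Mapping.map_key \<pi> :: (nat \<Rightarrow>\<^sub>0 nat) \<Rightarrow> _)"
proof (rule injI)
  fix p r :: "nat \<Rightarrow>\<^sub>0 nat"
  assume eq: "Poly_Mapping.map_key \<pi> p = Poly_Mapping.map_key \<pi> r"
  have "Poly_Mapping.lookup p i = Poly_Mapping.lookup r i" for i
    using arg_cong[OF eq, of "\<lambda>m. Poly_Mapping.lookup m (inv_into UNIV \<pi> i)"]
    by (simp add: map_key.rep_eq permutes_inj[OF assms] permutes_inverses[OF assms])
  then show "p = r"
    by (intro poly_mapping_eqI)
qed

lemma mpermute_mvar:
  assumes "\<pi> permutes A"
  shows "mpermute \<pi> (mvar i) = mvar (\<pi> i)"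
proof -
  have "Poly_Mapping.single i 1 =
      Poly_Mapping.map_key \<pi> (Poly_Mapping.single (\<pi> i) (1::nat))"
    using permutes_inj[OF assms] by (simp add: map_key_single)
  then show ?thesis
    unfolding mpermute_def mvar_def
    by (simp only: map_key_single[OF inj_map_key_permutes[OF assms]])
qed

section \<open>The partition function\<close>

text \<open>
  The formula is written over an arbitrary field; \<open>u\<close>, \<open>x\<close>, \<open>y\<close> are sequences of which only
  the first \<open>m\<close> resp. \<open>n\<close> entries (counted from 0) are used.
\<close>

definition vandermonde :: "nat \<Rightarrow> (nat \<Rightarrow> 'a::field) \<Rightarrow> 'a" where
  "vandermonde m u = (\<Prod>i<m. \<Prod>j\<in>{i<..<m}. u i - u j)"

text \<open>The sequence \<open>x\<^sub>0, q\<^sup>2 x\<^sub>0, \<dots>, q\<^bsup>2l-2\<^esup> x\<^sub>0, x\<^sub>1, q\<^sup>2 x\<^sub>1, \<dots>\<close>.\<close>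

definition bar :: "nat \<Rightarrow> 'a::field \<Rightarrow> (nat \<Rightarrow> 'a) \<Rightarrow> nat \<Rightarrow> 'a" where
  "bar l q x k = q ^ (2 * (k mod l)) * x (k div l)"

definition A_entry :: "'a::field \<Rightarrow> 'a \<Rightarrow> 'a \<Rightarrow> nat \<Rightarrow> nat \<Rightarrow> 'a" where
  "A_entry q x y i j =
     1 / ((q ^ (2 * j) * x - q powi (2 * int i - 1) * y) *
          (q ^ (2 * j) * x - q powi (2 * int i + 1) * y))"

text \<open>Row \<open>\<alpha> l + i\<close> and column \<open>\<beta> l + j\<close> carry entry \<open>(i, j)\<close> of the block \<open>(\<alpha>, \<beta>)\<close>.\<close>

definition A_mat :: "nat \<Rightarrow> nat \<Rightarrow> 'a::field \<Rightarrow> (nat \<Rightarrow> 'a) \<Rightarrow> (nat \<Rightarrow> 'a) \<Rightarrow> 'a mat" where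
  "A_mat n l q x y =
     mat (l * n) (l * n)
       (\<lambda>(r, c). A_entry q (x (r div l)) (y (c div l)) (r mod l) (c mod l))"

definition partition_fn ::
    "nat \<Rightarrow> nat \<Rightarrow> 'a::field \<Rightarrow> (nat \<Rightarrow> 'a) \<Rightarrow> (nat \<Rightarrow> 'a) \<Rightarrow> 'a" where
  "partition_fn n l q x y =
     (\<Prod>i<n. \<Prod>j<n. \<Prod>p\<le>l. \<Prod>k<l.
        q ^ (2 * k) * x i - q powi (2 * int p - 1) * y j) /
     (vandermonde (l * n) (bar l q x) * vandermonde (l * n) (bar l q y)) *
     det (A_mat n l q x y)"

text \<open>
  The partition function as a rational function over the complex numbers, with the parameter
  \<open>q\<close> a complex number. The variables with indices \<open>0, \<dots>, n - 1\<close> are the \<open>x\<close>'s and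
  those with indices \<open>n, \<dots>, 2n - 1\<close> the \<open>y\<close>'s. If \<open>q\<close> is nonzero and the powers
  \<open>q\<^bsup>2k\<^esup>\<close> for \<open>k < l\<close> are pairwise distinct (as for a primitive root of unity of order
  \<open>2l + 1\<close>), then no denominator vanishes in the field of rational functions.
\<close>

definition Z_rat :: "nat \<Rightarrow> nat \<Rightarrow> complex \<Rightarrow> complex mpol fract" where
  "Z_rat n l q =
     partition_fn n l (to_fract (mconst q))
       (\<lambda>i. to_fract (mvar i)) (\<lambda>j. to_fract (mvar (n + j)))"

definition rho :: "nat \<Rightarrow> complex" where
  "rho l = exp (2 * of_real pi * \<i> / of_nat (2 * l + 1))"

end

theory Submission
  imports Defs
begin

text \<open>
  Put \<open>N = 2 l + 1\<close>, so that \<open>q = rho l\<close> is a primitive \<open>N\<close>-th root of unity, collect the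
  \<open>x\<close>'s and the \<open>y\<close>'s in one sequence \<open>z\<close> of length \<open>2 n\<close>, and let \<open>u\<close> be the sequence of all
  \<open>q ^ (2 k) z\<^sub>a\<close> with \<open>k < l\<close>. The partition function is a constant multiple of the quotient
  of the alternant \<open>det [u\<^sub>r ^ e\<^sub>c]\<close> by the Vandermonde determinant of \<open>u\<close>, where the exponents
  \<open>e\<^sub>c\<close> run through the \<open>2 l n\<close> numbers below \<open>N n\<close> that are not congruent to \<open>N - 1\<close> modulo
  \<open>N\<close>. Such a quotient (a Schur polynomial) is a polynomial in \<open>u\<close>, and since a permutation of
  the \<open>z\<^sub>a\<close> permutes the rows of both determinants in the same way, it is symmetric in \<open>z\<close>
  (\<open>det_alternant\<close>, \<open>alternant_quotient_invariant\<close>).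

  These exponents arise as follows. The two factors of the weight
  \<open>1 / ((Y - q X) (Y - q ^ -1 X))\<close> divide \<open>Y ^ N - X ^ N\<close>, and the quotient is a polynomial
  in \<open>Y\<close> of degree \<open>N - 2\<close>: the exponent \<open>N - 1\<close> is skipped. Let
  \<open>P t = (t - x\<^sub>1 ^ N) \<dots> (t - x\<^sub>n ^ N)\<close>. Combined with the ordinary Bezout kernel
  \<open>(P s - P t) / (s - t)\<close> this shows that
  \<open>K Y X = (q - q ^ -1) (P (Y ^ N) - P (X ^ N)) / ((Y - q X) (Y - q ^ -1 X))\<close> is a bilinear form in
  the two vectors of powers \<open>Y ^ e\<^sub>c\<close> and \<open>X ^ e\<^sub>c\<close> (\<open>bezout_kernel_identity\<close>). Its matrix is
  antitriangular with antidiagonal entries that depend on \<open>q\<close> only, so its determinant is a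
  constant (\<open>det_bezout_form\<close>).

  Now evaluate \<open>K\<close> at all pairs of entries of \<open>u\<close>. Pairs of entries that both belong to \<open>x\<close>
  give \<open>0\<close>, because \<open>P\<close> vanishes at the \<open>x\<^sub>a ^ N\<close>; a mixed pair gives, up to a factor
  \<open>P (Y ^ N)\<close> and a constant, an entry of a matrix with the determinant that defines the
  partition function (\<open>det_A_mat\<close>). Hence the square of that determinant times the
  square of the product of the \<open>P (Y ^ N)\<close> over the entries \<open>Y\<close> of \<open>u\<close> that belong to \<open>y\<close>
  is a constant times the square of the alternant (\<open>weight_det_square\<close>). As the product of the
  \<open>X - q ^ (2 m) Y\<close> over all \<open>m < N\<close> is \<open>X ^ N - Y ^ N\<close>, the prefactor of the partition function
  together with the part of the Vandermonde determinant of \<open>u\<close> that mixes \<open>x\<close> and \<open>y\<close> is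
  exactly, up to sign, that product of the \<open>P (Y ^ N)\<close> (\<open>prefactor_square\<close>). Thus the square of
  the partition function is a constant times the square of the alternant quotient, and since
  complex numbers have square roots, the partition function itself is a constant times the
  alternant quotient.
\<close>

section \<open>Determinants and indices in blocks\<close>

lemma (in comm_monoid_set) lessThan_mult:
  fixes k n :: nat
  shows "F g {..<k * n} = F (\<lambda>m. F (\<lambda>r. g (m * k + r)) {..<k}) {..<n}"
proof (induction n)
  case (Suc n)
  have "F g {..<k * Suc n} = F g ({..<k * n} \<union> {k * n..<k * n + k})"
    by (intro arg_cong[where f = "F g"]) auto
  also have "\<dots> = f (F g {..<k * n}) (F g {k * n..<k * n + k})"
    by (intro union_disjoint) auto
  also have "F g {k * n..<k * n + k} = F (\<lambda>r. g (n * k + r)) {..<k}"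
    by (rule reindex_bij_witness[of _ "\<lambda>r. n * k + r" "\<lambda>r. r - n * k"]) (auto simp: mult.commute)
  finally show ?case
    by (simp add: Suc.IH)
qed simp

lemma index_mult_add_less:
  fixes m n k r :: nat
  assumes "m < n" "r < k"
  shows "m * k + r < k * n"
proof -
  have "m * k + r < Suc m * k" using assms by simp
  also have "\<dots> \<le> n * k" using assms by (intro mult_le_mono1) simp
  finally show ?thesis by (simp add: mult.commute)
qed

lemma det_scale:
  fixes F :: "nat \<Rightarrow> nat \<Rightarrow> 'a::comm_ring_1"
  shows "det (mat n n (\<lambda>(i, j). d i * e j * F i j)) =
    (\<Prod>i<n. d i) * (\<Prod>j<n. e j) * det (mat n n (\<lambda>(i, j). F i j))"
proof -
  have "signof p * (\<Prod>i = 0..<n. mat n n (\<lambda>(i, j). d i * e j * F i j) $$ (i, p i)) =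
      (\<Prod>i<n. d i) * (\<Prod>j<n. e j) *
        (signof p * (\<Prod>i = 0..<n. mat n n (\<lambda>(i, j). F i j) $$ (i, p i)))"
    if p: "p permutes {0..<n}" for p
  proof -
    have "(\<Prod>i = 0..<n. mat n n (\<lambda>(i, j). d i * e j * F i j) $$ (i, p i)) =
        (\<Prod>i = 0..<n. d i * e (p i) * mat n n (\<lambda>(i, j). F i j) $$ (i, p i))"
      using permutes_in_image[OF p] by (intro prod.cong) auto
    also have "\<dots> = (\<Prod>i<n. d i) * (\<Prod>j<n. e j) *
        (\<Prod>i = 0..<n. mat n n (\<lambda>(i, j). F i j) $$ (i, p i))"
      using prod.permute[OF p, of e] by (simp add: prod.distrib atLeast0LessThan comp_def)
    finally show ?thesis
      by (simp only: mult_ac)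
  qed
  then show ?thesis
    unfolding det_def'[OF mat_carrier] sum_distrib_left
    by (intro sum.cong refl) (simp only: mem_Collect_eq)
qed

lemma det_relabel:
  fixes F :: "nat \<Rightarrow> nat \<Rightarrow> 'a::comm_ring_1"
  assumes p: "p permutes {0..<n}"
  shows "det (mat n n (\<lambda>(i, j). F (p i) (p j))) = det (mat n n (\<lambda>(i, j). F i j))"
proof -
  have in_n: "p i < n \<longleftrightarrow> i < n" for i
    using permutes_in_image[OF p] by auto
  let ?M = "mat n n (\<lambda>(i, j). F i j)"
  let ?R = "mat n n (\<lambda>(i, j). F (p i) j)"
  have "det (mat n n (\<lambda>(i, j). F (p i) (p j))) =
      det (mat n n (\<lambda>(i, j). transpose_mat ?R $$ (p i, j)))"
    by (subst det_transpose[symmetric, of _ n]) (auto intro!: arg_cong[where f = det] simp: in_n)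
  also have "\<dots> = signof p * det ?R"
    by (subst det_permute_rows[OF _ p]) (auto simp: det_transpose[of _ n])
  also have "?R = mat n n (\<lambda>(i, j). ?M $$ (p i, j))"
    by (auto simp: in_n)
  also have "det \<dots> = signof p * det ?M"
    by (rule det_permute_rows[OF _ p]) simp
  finally show ?thesis
    by (simp add: sign_def)
qed

text \<open>Reversing the rows makes the matrix triangular; only the sign of the reversal is left open.\<close>
lemma det_antitriangular:
  fixes F :: "nat \<Rightarrow> nat \<Rightarrow> 'a::comm_ring_1"
  assumes zero: "\<And>i j. i < n \<Longrightarrow> j < n \<Longrightarrow> n \<le> i + j \<Longrightarrow> F i j = 0"
  shows "\<exists>\<epsilon>\<in>{1, -1}. det (mat n n (\<lambda>(i, j). F i j)) = \<epsilon> * (\<Prod>j<n. F (n - 1 - j) j)"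
proof -
  define p where "p i = (if i < n then n - 1 - i else i)" for i
  have p: "p permutes {0..<n}"
    by (rule bij_imp_permutes, rule bij_betw_byWitness[of _ p]) (auto simp: p_def)
  have "det (mat n n (\<lambda>(i, j). mat n n (\<lambda>(i, j). F i j) $$ (p i, j))) =
      (\<Prod>j<n. F (n - 1 - j) j)"
    by (subst det_lower_triangular[of n])
      (auto simp: prod_list_diag_prod p_def zero atLeast0LessThan intro!: prod.cong)
  then have signed: "signof p * det (mat n n (\<lambda>(i, j). F i j)) = (\<Prod>j<n. F (n - 1 - j) j)"
    by (subst (asm) det_permute_rows[OF _ p]) auto
  have "det (mat n n (\<lambda>(i, j). F i j)) = signof p * (\<Prod>j<n. F (n - 1 - j) j)"
    unfolding signed[symmetric] by (simp add: sign_def)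
  then show ?thesis
    by (auto simp: sign_def)
qed

lemma vandermonde_append:
  "vandermonde (m + k) u = vandermonde m u * vandermonde k (\<lambda>i. u (m + i)) *
     (\<Prod>i<m. \<Prod>j<k. u i - u (m + j))"
proof -
  have "vandermonde (m + k) u = (\<Prod>i<m. \<Prod>j\<in>{i<..<m + k}. u i - u j) *
      (\<Prod>i\<in>{m..<m + k}. \<Prod>j\<in>{i<..<m + k}. u i - u j)"
    unfolding vandermonde_def
    by (subst prod.union_disjoint[symmetric]) (auto intro!: prod.cong)
  also have "(\<Prod>i\<in>{m..<m + k}. \<Prod>j\<in>{i<..<m + k}. u i - u j) =
      (\<Prod>i<k. \<Prod>j\<in>{m + i<..<m + k}. u (m + i) - u j)"
    by (rule prod.reindex_bij_witness[of _ "\<lambda>i. m + i" "\<lambda>i. i - m"]) auto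
  also have "\<dots> = vandermonde k (\<lambda>i. u (m + i))"
    unfolding vandermonde_def
    by (intro prod.cong refl prod.reindex_bij_witness[of _ "\<lambda>i. m + i" "\<lambda>i. i - m"]) auto
  also have "(\<Prod>i<m. \<Prod>j\<in>{i<..<m + k}. u i - u j) =
      (\<Prod>i<m. (\<Prod>j\<in>{i<..<m}. u i - u j) * (\<Prod>j\<in>{m..<m + k}. u i - u j))"
    by (intro prod.cong refl, subst prod.union_disjoint[symmetric]) (auto intro!: prod.cong)
  also have "\<dots> = (\<Prod>i<m. (\<Prod>j\<in>{i<..<m}. u i - u j) * (\<Prod>j<k. u i - u (m + j)))"
    by (intro prod.cong refl arg_cong2[where f = "(*)"]
        prod.reindex_bij_witness[of _ "\<lambda>i. m + i" "\<lambda>i. i - m"]) auto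
  finally show ?thesis
    by (simp add: prod.distrib vandermonde_def mult_ac)
qed

section \<open>Quotients of alternants by Vandermonde determinants\<close>

text \<open>
  The divided difference of \<open>x ^ k\<close> at the nodes \<open>u 0, \<dots>, u j\<close>, that is, the complete
  homogeneous symmetric polynomial of degree \<open>k - j\<close> in these nodes (\<open>0\<close> for \<open>k < j\<close>). The
  recursion is the one of complete homogeneous polynomials: a monomial either avoids the last
  variable or is divisible by it. No division occurs, so the entries stay in the ring.
\<close>
fun divided_power :: "(nat \<Rightarrow> 'a::comm_ring_1) \<Rightarrow> nat \<Rightarrow> nat \<Rightarrow> 'a" where
  "divided_power u 0 0 = 1"
| "divided_power u 0 (Suc k) = u 0 * divided_power u 0 k"
| "divided_power u (Suc j) 0 = 0"
| "divided_power u (Suc j) (Suc k) = divided_power u j k + u (Suc j) * divided_power u (Suc j) k"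

lemma divided_power_eq_0: "k < j \<Longrightarrow> divided_power u j k = 0"
  by (induction u j k rule: divided_power.induct) auto

lemma divided_power_diag: "divided_power u j j = 1"
  by (induction j) (auto simp: divided_power_eq_0)

text \<open>
  Newton interpolation of \<open>x ^ k\<close>. The step multiplies a Newton basis polynomial by
  \<open>x = (x - u j) + u j\<close>. Any bound \<open>m\<close> from \<open>k\<close> on is
  admissible because the coefficients beyond \<open>k\<close> vanish.
\<close>
lemma newton_expansion:
  assumes "k \<le> m"
  shows "x ^ k = (\<Sum>j\<le>m. divided_power u j k * (\<Prod>i<j. x - u i))"
  using assms
proof (induction k arbitrary: m)
  case 0
  have "(\<Sum>j\<le>m. divided_power u j 0 * (\<Prod>i<j. x - u i)) = (\<Sum>j\<le>m. if j = 0 then 1 else 0)"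
    by (intro sum.cong refl) (auto simp: divided_power_eq_0)
  then show ?case
    by simp
next
  case (Suc k)
  then obtain m' where m': "m = Suc m'" "k \<le> m'"
    by (cases m) auto
  let ?N = "\<lambda>j. \<Prod>i<j. x - u i"
  have "x ^ Suc k = (\<Sum>j\<le>m'. divided_power u j k * (?N (Suc j) + u j * ?N j))"
    unfolding power_Suc Suc.IH[OF m'(2)] sum_distrib_left
    by (intro sum.cong refl) (simp add: algebra_simps)
  also have "\<dots> = (\<Sum>j\<le>m'. divided_power u j k * ?N (Suc j)) + (\<Sum>j\<le>m'. u j * divided_power u j k * ?N j)"
    by (simp only: distrib_left sum.distrib mult_ac)
  also have "(\<Sum>j\<le>m'. u j * divided_power u j k * ?N j) = (\<Sum>j\<le>Suc m'. u j * divided_power u j k * ?N j)"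
    using m'(2) by (simp add: divided_power_eq_0)
  also have "\<dots> = u 0 * divided_power u 0 k + (\<Sum>j\<le>m'. u (Suc j) * divided_power u (Suc j) k * ?N (Suc j))"
    by (simp only: sum.atMost_Suc_shift) simp
  finally show ?case
    unfolding m'(1) sum.atMost_Suc_shift
    by (simp add: sum.distrib distrib_right del: prod.lessThan_Suc)
qed

text \<open>
  The Vandermonde determinant over a ring, with the sign convention of the power matrix; it agrees
  with \<open>vandermonde\<close> up to sign (\<open>newton_vandermonde_square\<close>).
\<close>
definition newton_vandermonde :: "nat \<Rightarrow> (nat \<Rightarrow> 'a::comm_ring_1) \<Rightarrow> 'a" where
  "newton_vandermonde m u = (\<Prod>j<m. \<Prod>i<j. u j - u i)"

definition alternant_quotient :: "nat \<Rightarrow> (nat \<Rightarrow> nat) \<Rightarrow> (nat \<Rightarrow> 'a::comm_ring_1) \<Rightarrow> 'a" where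
  "alternant_quotient m e u = det (mat m m (\<lambda>(j, c). divided_power u j (e c)))"

text \<open>
  At the nodes themselves the Newton basis is triangular, so the Newton expansion of the powers
  factors the alternant into a triangular matrix with determinant \<open>newton_vandermonde\<close> and the
  matrix of divided differences. This is the Jacobi-Trudi factorization, and it exhibits the
  quotient as a polynomial in the nodes.
\<close>
lemma det_alternant:
  "det (mat m m (\<lambda>(r, c). u r ^ e c)) = newton_vandermonde m u * alternant_quotient m e u"
proof -
  let ?L = "mat m m (\<lambda>(r, j). \<Prod>i<j. u r - u i)"
  let ?H = "mat m m (\<lambda>(j, c). divided_power u j (e c))"
  have expand: "u r ^ k = (\<Sum>j<m. (\<Prod>i<j. u r - u i) * divided_power u j k)" if "r < m" for r k
  proof -
    have vanish: "(\<Prod>i<j. u r - u i) = 0" if "r < j" for j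
      using that by (intro prod_zero) auto
    have "u r ^ k = (\<Sum>j\<le>k + m. divided_power u j k * (\<Prod>i<j. u r - u i))"
      by (rule newton_expansion) simp
    also have "\<dots> = (\<Sum>j<m. divided_power u j k * (\<Prod>i<j. u r - u i))"
      using that by (intro sum.mono_neutral_right) (auto simp: vanish)
    finally show ?thesis
      by (simp only: mult.commute)
  qed
  have "mat m m (\<lambda>(r, c). u r ^ e c) = ?L * ?H"
    by (rule eq_matI) (auto simp: scalar_prod_def atLeast0LessThan expand)
  moreover have "det ?L = newton_vandermonde m u"
    by (subst det_lower_triangular[of m])
      (auto simp: prod_list_diag_prod newton_vandermonde_def atLeast0LessThan intro!: prod_zero)
  ultimately show ?thesis
    by (simp add: det_mult[of _ m] alternant_quotient_def)
qed

lemma det_power_mat: "det (mat m m (\<lambda>(r, c). u r ^ c)) = newton_vandermonde m u"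
proof -
  have "alternant_quotient m (\<lambda>c. c) u = 1"
    unfolding alternant_quotient_def
    by (subst det_upper_triangular[of _ m])
      (auto simp: upper_triangular_def prod_list_diag_prod divided_power_eq_0 divided_power_diag)
  then show ?thesis
    using det_alternant[of m u "\<lambda>c. c"] by simp
qed

lemma newton_vandermonde_square: "(newton_vandermonde m u)\<^sup>2 = (vandermonde m u)\<^sup>2"
proof -
  have "(newton_vandermonde m u)\<^sup>2 = (\<Prod>j<m. \<Prod>i<j. (u i - u j)\<^sup>2)"
    unfolding newton_vandermonde_def prod_power_distrib by (simp only: power2_commute)
  also have "\<dots> = (\<Prod>i<m. \<Prod>j\<in>{i<..<m}. (u i - u j)\<^sup>2)"
    by (simp add: prod.Sigma)
      (rule prod.reindex_bij_witness[of _ "\<lambda>(i, j). (j, i)" "\<lambda>(j, i). (i, j)"]; auto)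
  finally show ?thesis
    unfolding vandermonde_def prod_power_distrib .
qed

text \<open>
  A ring endomorphism that permutes the nodes multiplies every alternant by the sign of the
  permutation. The Vandermonde determinant is the alternant with exponents \<open>0, 1, 2, \<dots>\<close>, hence
  the sign cancels in the quotient.
\<close>
lemma alternant_quotient_invariant:
  fixes h :: "'a::idom \<Rightarrow> 'a"
  assumes "comm_ring_hom h" and u: "\<And>r. r < m \<Longrightarrow> h (u r) = u (\<sigma> r)"
    and \<sigma>: "\<sigma> permutes {0..<m}" and nz: "newton_vandermonde m u \<noteq> 0"
  shows "h (alternant_quotient m e u) = alternant_quotient m e u"
proof -
  interpret comm_ring_hom h by fact
  have h_det: "h (det (mat m m (\<lambda>(r, c). u r ^ f c))) = signof \<sigma> * det (mat m m (\<lambda>(r, c). u r ^ f c))"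
    for f :: "nat \<Rightarrow> nat"
  proof -
    have "h (det (mat m m (\<lambda>(r, c). u r ^ f c))) = det (map_mat h (mat m m (\<lambda>(r, c). u r ^ f c)))"
      by (rule hom_det[symmetric])
    also have "map_mat h (mat m m (\<lambda>(r, c). u r ^ f c)) =
        mat m m (\<lambda>(r, c). mat m m (\<lambda>(r, c). u r ^ f c) $$ (\<sigma> r, c))"
      using permutes_in_image[OF \<sigma>] by (intro eq_matI) (auto simp: hom_power u)
    also have "det \<dots> = signof \<sigma> * det (mat m m (\<lambda>(r, c). u r ^ f c))"
      by (rule det_permute_rows[OF _ \<sigma>]) simp
    finally show ?thesis .
  qed
  have "h (newton_vandermonde m u) = signof \<sigma> * newton_vandermonde m u"
    using h_det[of "\<lambda>c. c"] by (simp only: det_power_mat)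
  moreover have "h (newton_vandermonde m u) * h (alternant_quotient m e u) =
      signof \<sigma> * (newton_vandermonde m u * alternant_quotient m e u)"
    using h_det[of e] by (simp only: det_alternant hom_mult)
  ultimately show ?thesis
    using nz by (auto simp: sign_def split: if_splits)
qed

section \<open>The Bezout kernel\<close>

text \<open>
  The \<open>c\<close>-th natural number that is not congruent to \<open>2 l\<close> modulo \<open>2 l + 1\<close>: block \<open>c div (2 l)\<close>
  holds the first \<open>2 l\<close> residues of one period.
\<close>
definition expo :: "nat \<Rightarrow> nat \<Rightarrow> nat" where
  "expo l c = (2 * l + 1) * (c div (2 * l)) + c mod (2 * l)"

text \<open>
  For \<open>a\<close> the coefficients of a polynomial \<open>P\<close> of degree \<open>n\<close>, the factor with \<open>a\<close> is the
  coefficient of \<open>s ^ i t ^ j\<close> in \<open>(P s - P t) / (s - t)\<close>, with \<open>i, j\<close> the block numbers. The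
  other factor is \<open>(q - q ^ -1)\<close> times the \<open>q\<close>-number of \<open>2 l - r\<close>, with \<open>r\<close> the position of \<open>c\<close>
  in its block; \<open>q ^ (r + 1)\<close> stands for \<open>q ^ (r - 2 l)\<close>, which is the same when
  \<open>q ^ (2 l + 1) = 1\<close>.
\<close>
definition bezout_form :: "nat \<Rightarrow> nat \<Rightarrow> 'a::comm_ring_1 \<Rightarrow> (nat \<Rightarrow> 'a) \<Rightarrow> nat \<Rightarrow> nat \<Rightarrow> 'a" where
  "bezout_form n l q a c d =
     (if c mod (2 * l) + d mod (2 * l) = 2 * l - 1 \<and> c div (2 * l) + d div (2 * l) < n
      then a (c div (2 * l) + d div (2 * l) + 1) *
        (q ^ (2 * l - c mod (2 * l)) - q ^ (c mod (2 * l) + 1))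
      else 0)"

definition bezout_kernel :: "nat \<Rightarrow> nat \<Rightarrow> 'a::comm_ring_1 \<Rightarrow> (nat \<Rightarrow> 'a) \<Rightarrow> 'a \<Rightarrow> 'a \<Rightarrow> 'a" where
  "bezout_kernel n l q a Y X =
     (\<Sum>c<2 * l * n. \<Sum>d<2 * l * n. Y ^ expo l c * bezout_form n l q a c d * X ^ expo l d)"

text \<open>
  With \<open>h = q ^ (2 l)\<close>, the inverse of \<open>q\<close>, each of the two parts of the coefficient gives a
  geometric sum, and these are the quotients of \<open>Y ^ (2 l) - (q X) ^ (2 l)\<close> and
  \<open>Y ^ (2 l) - (h X) ^ (2 l)\<close> by the two linear factors. The mixed terms cancel because
  \<open>q h = 1\<close>.
\<close>
lemma q_number_kernel:
  fixes q X Y :: "'a::comm_ring_1"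
  assumes q: "q ^ (2 * l + 1) = 1"
  shows "(Y - q * X) * (Y - q ^ (2 * l) * X) *
      (\<Sum>r<2 * l. (q ^ (2 * l - r) - q ^ (r + 1)) * Y ^ r * X ^ (2 * l - 1 - r)) =
    (q - q ^ (2 * l)) * (Y ^ (2 * l + 1) - X ^ (2 * l + 1))"
proof -
  define h where "h = q ^ (2 * l)"
  have hq: "h * q = 1"
    using q by (simp add: h_def mult.commute)
  have h_pow: "h ^ i * q ^ i = 1" for i
    by (metis hq power_mult_distrib power_one)
  have h2l: "h ^ (2 * l) = q"
  proof -
    have "h ^ (2 * l) = h ^ (2 * l) * (h * q)" by (simp add: hq)
    also have "\<dots> = (h ^ (2 * l) * q ^ (2 * l)) * q" by (simp add: h_def mult_ac)
    finally show ?thesis by (simp add: h_pow)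
  qed
  have q_term: "q ^ (2 * l - r) = q * q ^ (2 * l - 1 - r)" if "r < 2 * l" for r
    using that by (simp add: Suc_diff_Suc flip: power_Suc)
  have h_term: "q ^ (r + 1) = h * h ^ (2 * l - 1 - r)" if "r < 2 * l" for r
  proof -
    have "q ^ (r + 1) = q ^ (r + 1) * (h ^ (2 * l - r) * q ^ (2 * l - r))"
      by (simp add: h_pow)
    also have "\<dots> = q ^ (r + 1 + (2 * l - r)) * h ^ (2 * l - r)"
      by (simp add: power_add mult_ac)
    also have "r + 1 + (2 * l - r) = 2 * l + 1"
      using that by simp
    also have "h ^ (2 * l - r) = h * h ^ (2 * l - 1 - r)"
      using that by (simp add: Suc_diff_Suc flip: power_Suc)
    finally show ?thesis
      using q by simp
  qed
  have geom: "(Y - g * X) * (\<Sum>r<2 * l. g * g ^ (2 * l - 1 - r) * Y ^ r * X ^ (2 * l - 1 - r)) =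
      g * (Y ^ (2 * l) - (g * X) ^ (2 * l))" for g
    unfolding power_diff_sumr2[of Y _ "g * X"]
    by (simp add: sum_distrib_left power_mult_distrib mult_ac)
  have regroup: "u * v * (s - t) = v * (u * s) - u * (v * t)" for u v s t :: 'a
    by (simp add: algebra_simps)
  let ?Q = "\<Sum>r<2 * l. q * q ^ (2 * l - 1 - r) * Y ^ r * X ^ (2 * l - 1 - r)"
  let ?H = "\<Sum>r<2 * l. h * h ^ (2 * l - 1 - r) * Y ^ r * X ^ (2 * l - 1 - r)"
  have "(\<Sum>r<2 * l. (q ^ (2 * l - r) - q ^ (r + 1)) * Y ^ r * X ^ (2 * l - 1 - r)) = ?Q - ?H"
    unfolding sum_subtractf[symmetric]
    by (intro sum.cong) (simp_all only: lessThan_iff q_term h_term left_diff_distrib)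
  then have "(Y - q * X) * (Y - h * X) *
      (\<Sum>r<2 * l. (q ^ (2 * l - r) - q ^ (r + 1)) * Y ^ r * X ^ (2 * l - 1 - r)) =
      (Y - h * X) * ((Y - q * X) * ?Q) - (Y - q * X) * ((Y - h * X) * ?H)"
    by (simp only: regroup)
  also have "\<dots> = (Y - h * X) * (q * (Y ^ (2 * l) - h * X ^ (2 * l))) -
      (Y - q * X) * (h * (Y ^ (2 * l) - q * X ^ (2 * l)))"
    by (simp only: geom power_mult_distrib h2l h_def[symmetric])
  also have "\<dots> = (q - h) * (Y * Y ^ (2 * l)) - (h * q) * (q - h) * (X * X ^ (2 * l))"
    by (simp add: algebra_simps)
  also have "\<dots> = (q - h) * (Y ^ (2 * l + 1) - X ^ (2 * l + 1))"
    by (simp only: hq mult_1 right_diff_distrib Suc_eq_plus1[symmetric] power_Suc)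
  finally show ?thesis
    by (simp only: h_def)
qed

text \<open>
  Writing indices as block number and position separates the double sum into a sum over pairs of
  blocks and a sum over positions, since the condition on the positions leaves one position of the
  second index for each position of the first.
\<close>
lemma bezout_kernel_factor:
  assumes "l \<ge> 1"
  shows "bezout_kernel n l q a Y X =
    (\<Sum>j<n. \<Sum>k<n - j. a (j + k + 1) * (X ^ (2 * l + 1)) ^ k * (Y ^ (2 * l + 1)) ^ j) *
    (\<Sum>r<2 * l. (q ^ (2 * l - r) - q ^ (r + 1)) * Y ^ r * X ^ (2 * l - 1 - r))"
proof -
  define N where "N = 2 * l + 1"
  define b where "b r = q ^ (2 * l - r) - q ^ (r + 1)" for r
  have dm: "(m * (2 * l) + r) div (2 * l) = m" "(m * (2 * l) + r) mod (2 * l) = r"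
    if "r < 2 * l" for m r
    using that by auto
  have inner: "(\<Sum>r'<2 * l. Y ^ (N * m + r) *
        (if r + r' = 2 * l - 1 \<and> m + k < n then a (m + k + 1) * b r else 0) * X ^ (N * k + r')) =
      (if m + k < n then a (m + k + 1) * (X ^ N) ^ k * (Y ^ N) ^ m * (b r * Y ^ r * X ^ (2 * l - 1 - r))
       else 0)" if r: "r < 2 * l" for m r k
  proof -
    have "(\<Sum>r'<2 * l. Y ^ (N * m + r) *
        (if r + r' = 2 * l - 1 \<and> m + k < n then a (m + k + 1) * b r else 0) * X ^ (N * k + r')) =
      (\<Sum>r'<2 * l. if r' = 2 * l - 1 - r then Y ^ (N * m + r) *
        (if m + k < n then a (m + k + 1) * b r else 0) * X ^ (N * k + (2 * l - 1 - r)) else 0)"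
      using r by (intro sum.cong refl) auto
    also have "\<dots> = Y ^ (N * m + r) *
        (if m + k < n then a (m + k + 1) * b r else 0) * X ^ (N * k + (2 * l - 1 - r))"
      using assms by (subst sum.delta) auto
    finally show ?thesis
      by (simp add: power_add power_mult mult_ac)
  qed
  have "bezout_kernel n l q a Y X = (\<Sum>m<n. \<Sum>r<2 * l. \<Sum>k<n. \<Sum>r'<2 * l. Y ^ (N * m + r) *
        (if r + r' = 2 * l - 1 \<and> m + k < n then a (m + k + 1) * b r else 0) * X ^ (N * k + r'))"
    unfolding bezout_kernel_def sum.lessThan_mult
    by (intro sum.cong refl) (simp only: lessThan_iff expo_def bezout_form_def dm N_def b_def)
  also have "\<dots> = (\<Sum>m<n. \<Sum>r<2 * l. \<Sum>k<n. if m + k < n then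
      a (m + k + 1) * (X ^ N) ^ k * (Y ^ N) ^ m * (b r * Y ^ r * X ^ (2 * l - 1 - r)) else 0)"
    by (intro sum.cong refl inner) simp
  also have "\<dots> = (\<Sum>m<n. \<Sum>r<2 * l. \<Sum>k<n - m.
      a (m + k + 1) * (X ^ N) ^ k * (Y ^ N) ^ m * (b r * Y ^ r * X ^ (2 * l - 1 - r)))"
    by (intro sum.cong refl sum.mono_neutral_cong_right) auto
  also have "\<dots> = (\<Sum>m<n. \<Sum>k<n - m. a (m + k + 1) * (X ^ N) ^ k * (Y ^ N) ^ m *
      (\<Sum>r<2 * l. b r * Y ^ r * X ^ (2 * l - 1 - r)))"
    by (subst sum.swap) (simp add: sum_distrib_left)
  finally show ?thesis
    by (simp add: sum_distrib_right N_def b_def)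
qed

lemma bezout_kernel_identity:
  fixes q X Y :: "'a::idom"
  assumes "n \<ge> 1" "l \<ge> 1" and q: "q ^ (2 * l + 1) = 1"
  shows "(Y - q * X) * (Y - q ^ (2 * l) * X) * bezout_kernel n l q a Y X =
    (q - q ^ (2 * l)) *
      ((\<Sum>i\<le>n. a i * (Y ^ (2 * l + 1)) ^ i) - (\<Sum>i\<le>n. a i * (X ^ (2 * l + 1)) ^ i))"
proof -
  let ?B = "\<Sum>j<n. \<Sum>k<n - j. a (j + k + 1) * (X ^ (2 * l + 1)) ^ k * (Y ^ (2 * l + 1)) ^ j"
  have regroup: "u * (b * s) = u * s * b" for u b s :: 'a
    by simp
  have "(Y - q * X) * (Y - q ^ (2 * l) * X) * bezout_kernel n l q a Y X =
      ((Y - q * X) * (Y - q ^ (2 * l) * X) *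
        (\<Sum>r<2 * l. (q ^ (2 * l - r) - q ^ (r + 1)) * Y ^ r * X ^ (2 * l - 1 - r))) * ?B"
    unfolding bezout_kernel_factor[OF assms(2)] by (rule regroup)
  also have "\<dots> = (q - q ^ (2 * l)) * ((Y ^ (2 * l + 1) - X ^ (2 * l + 1)) * ?B)"
    unfolding q_number_kernel[OF q] by (rule mult.assoc)
  finally show ?thesis
    by (simp only: polyfun_diff_alt[OF assms(1)])
qed

text \<open>
  Block numbers of a nonzero entry add up to at most \<open>n - 1\<close> and positions to exactly \<open>2 l - 1\<close>, so
  the indices add up to at most \<open>2 l n - 1\<close>, with equality exactly when the leading coefficient of
  \<open>P\<close> occurs. For a monic \<open>P\<close> the antidiagonal therefore involves only \<open>q\<close>.
\<close>
lemma det_bezout_form: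
  fixes q :: "'a::comm_ring_1"
  assumes "l \<ge> 1" and a: "a n = 1"
  shows "\<exists>\<epsilon>\<in>{1, -1}. det (mat (2 * l * n) (2 * l * n) (\<lambda>(c, d). bezout_form n l q a c d)) =
    \<epsilon> * (\<Prod>d<2 * l * n. q ^ (d mod (2 * l) + 1) - q ^ (2 * l - d mod (2 * l)))"
proof -
  let ?M = "2 * l * n"
  have divmod: "c = 2 * l * (c div (2 * l)) + c mod (2 * l)" for c
    by simp
  have zero: "bezout_form n l q a c d = 0" if "?M \<le> c + d" for c d
  proof (rule ccontr)
    assume "bezout_form n l q a c d \<noteq> 0"
    then have r: "c mod (2 * l) + d mod (2 * l) = 2 * l - 1" and
      m: "c div (2 * l) + d div (2 * l) + 1 \<le> n"
      by (auto simp: bezout_form_def split: if_splits)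
    have "c + d = 2 * l * (c div (2 * l) + d div (2 * l)) + (c mod (2 * l) + d mod (2 * l))"
      by (subst (1) divmod[of c], subst (1) divmod[of d]) (simp only: distrib_left ac_simps)
    also have "\<dots> < 2 * l * (c div (2 * l) + d div (2 * l) + 1)"
      using assms(1) by (simp add: r)
    also have "\<dots> \<le> ?M"
      using m by (intro mult_le_mono2)
    finally show False
      using that by simp
  qed
  have diag: "bezout_form n l q a (?M - 1 - d) d =
      q ^ (d mod (2 * l) + 1) - q ^ (2 * l - d mod (2 * l))" if d: "d < ?M" for d
  proof -
    define k r where "k = d div (2 * l)" and "r = d mod (2 * l)"
    have k: "k < n"
      using d by (simp add: k_def less_mult_imp_div_less mult.commute)
    have r: "r < 2 * l"
      using assms(1) by (simp add: r_def)
    have "?M - 1 - d = (n - 1 - k) * (2 * l) + (2 * l - 1 - r)"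
    proof -
      have "?M = (n - 1 - k) * (2 * l) + k * (2 * l) + 2 * l"
      proof -
        have "(n - 1 - k) * (2 * l) + k * (2 * l) + 2 * l = (n - 1 - k + k + 1) * (2 * l)"
          by (simp only: distrib_right mult_1)
        also have "n - 1 - k + k + 1 = n"
          using k by simp
        finally show ?thesis
          by (simp only: mult.commute)
      qed
      moreover have "d = k * (2 * l) + r"
        by (simp only: k_def r_def div_mult_mod_eq)
      ultimately show ?thesis
        using r by simp
    qed
    moreover have "(m * (2 * l) + s) div (2 * l) = m" "(m * (2 * l) + s) mod (2 * l) = s"
      if "s < 2 * l" for m s
      using that by auto
    ultimately have "(?M - 1 - d) div (2 * l) = n - 1 - k" "(?M - 1 - d) mod (2 * l) = 2 * l - 1 - r"
      using r by (simp_all only: diff_less_mono2 less_imp_diff_less One_nat_def)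
    then show ?thesis
      using k r a by (simp add: bezout_form_def flip: k_def r_def)
        (simp add: Suc_diff_Suc flip: power_Suc)
  qed
  obtain \<epsilon> where "\<epsilon> \<in> {1, -1}" "det (mat ?M ?M (\<lambda>(c, d). bezout_form n l q a c d)) =
      \<epsilon> * (\<Prod>d<?M. bezout_form n l q a (?M - 1 - d) d)"
    using det_antitriangular[of ?M "bezout_form n l q a"] zero by blast
  moreover have "(\<Prod>d<?M. bezout_form n l q a (?M - 1 - d) d) =
      (\<Prod>d<?M. q ^ (d mod (2 * l) + 1) - q ^ (2 * l - d mod (2 * l)))"
    by (intro prod.cong refl diag) simp
  ultimately show ?thesis
    by (intro bexI[of _ \<epsilon>]) (simp_all only:)
qed

section \<open>The partition function at a root of unity\<close>

text \<open>Both sides are monic polynomials in \<open>X\<close> of degree \<open>N\<close> with the \<open>N\<close> roots \<open>w ^ m * Y\<close>.\<close>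
lemma prod_diff_roots_of_unity:
  fixes w X Y :: "'a::field"
  assumes "N > 0" and w: "w ^ N = 1" and inj: "inj_on (\<lambda>m. w ^ m) {..<N}"
  shows "(\<Prod>m<N. X - w ^ m * Y) = X ^ N - Y ^ N"
proof (cases "Y = 0")
  case True
  with assms show ?thesis by simp
next
  case False
  define p where "p = (\<Prod>m<N. [:- (w ^ m * Y), 1:])"
  define r where "r = monom 1 N - [:Y ^ N:]"
  have deg_p: "degree p = N"
    by (simp add: p_def degree_prod_sum_eq)
  have "p = r"
  proof (rule poly_eqI_degree_lead_coeff[of _ N _ "(\<lambda>m. w ^ m * Y) ` {..<N}"])
    have "lead_coeff p = 1"
      by (simp add: p_def lead_coeff_prod)
    then show "coeff p N = coeff r N"
      using \<open>N > 0\<close> by (simp add: deg_p r_def coeff_pCons split: nat.splits)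
    have "inj_on (\<lambda>m. w ^ m * Y) {..<N}"
      using inj False by (simp add: inj_on_def)
    then show "N \<le> card ((\<lambda>m. w ^ m * Y) ` {..<N})"
      by (simp add: card_image)
    show "degree p \<le> N"
      by (simp add: deg_p)
    show "degree r \<le> N"
      unfolding r_def by (intro degree_diff_le degree_monom_le) simp
    fix t assume "t \<in> (\<lambda>m. w ^ m * Y) ` {..<N}"
    then obtain m where m: "m < N" "t = w ^ m * Y"
      by auto
    have "t ^ N = (w ^ N) ^ m * Y ^ N"
      by (simp add: m power_mult_distrib mult.commute flip: power_mult)
    then have "poly r t = 0"
      by (simp add: r_def poly_monom w)
    moreover have "poly p t = 0"
      using m by (auto simp: p_def poly_prod)
    ultimately show "poly p t = poly r t"
      by simp
  qed
  then have "poly p X = poly r X"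
    by simp
  then show ?thesis
    by (simp add: p_def r_def poly_prod poly_monom)
qed

text \<open>
  The power \<open>q ^ (2 l)\<close> is the inverse of \<open>q\<close> at the roots of unity considered here; writing it
  this way keeps all exponents natural numbers.
\<close>
definition six_vertex_weight :: "nat \<Rightarrow> 'a::field \<Rightarrow> 'a \<Rightarrow> 'a \<Rightarrow> 'a" where
  "six_vertex_weight l q X Y = 1 / ((X - q * Y) * (X - q ^ (2 * l) * Y))"

text \<open>
  The sequence \<open>z\<close> lists the \<open>x\<close>'s at the indices below \<open>n\<close> and the \<open>y\<close>'s at the indices from
  \<open>n\<close> to \<open>2 n - 1\<close>. The condition \<open>generic\<close> says at once that \<open>q\<close> is a primitive root of unity,
  that no variable is zero, and that no two variables differ by a power of \<open>q\<close>, which covers all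
  denominators below.
\<close>
locale generic_spectral_parameters =
  fixes n l :: nat and q :: "'a::field" and z :: "nat \<Rightarrow> 'a"
  assumes n_pos: "n \<ge> 1" and l_pos: "l \<ge> 1"
    and q_root: "q ^ (2 * l + 1) = 1"
    and generic: "inj_on (\<lambda>(a, e). q ^ e * z a) ({..<2 * n} \<times> {..<2 * l + 1})"
begin

abbreviation "N \<equiv> 2 * l + 1"
abbreviation "M \<equiv> l * n"
abbreviation "u \<equiv> bar l q z"
abbreviation "wt \<equiv> six_vertex_weight l q"

lemma genericD:
  assumes "q ^ e * z a = q ^ f * z b" "a < 2 * n" "b < 2 * n" "e < N" "f < N"
  shows "a = b \<and> e = f"
  using inj_onD[OF generic, of "(a, e)" "(b, f)"] assms by auto

lemma q_inverse: "q ^ (2 * l) * q = 1" "q * q ^ (2 * l) = 1"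
  using q_root by (simp_all add: mult.commute)

lemma q_nonzero: "q \<noteq> 0"
  using q_inverse by auto

lemma q_power_inj: "inj_on (\<lambda>e. q ^ e) {..<N}"
proof (rule inj_onI)
  fix e f assume "e \<in> {..<N}" "f \<in> {..<N}" "q ^ e = q ^ f"
  then show "e = f"
    using genericD[of e 0 f 0] n_pos by simp
qed

lemma q_neq_inverse: "q \<noteq> q ^ (2 * l)"
proof
  assume "q = q ^ (2 * l)"
  then have "1 = 2 * l"
    using inj_onD[OF q_power_inj, of 1 "2 * l"] l_pos by simp
  then show False
    by simp
qed

text \<open>The order \<open>2 l + 1\<close> of \<open>q\<close> is odd, and \<open>l + 1\<close> inverts \<open>2\<close> modulo it.\<close>
lemma q_square_power_inj: "inj_on (\<lambda>m. (q\<^sup>2) ^ m) {..<N}"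
proof (rule inj_onI)
  fix e f assume "e \<in> {..<N}" "f \<in> {..<N}" and eq: "(q\<^sup>2) ^ e = (q\<^sup>2) ^ f"
  have "((q\<^sup>2) ^ e) ^ (l + 1) = q ^ e" for e
  proof -
    have "((q\<^sup>2) ^ e) ^ (l + 1) = (q ^ N) ^ e * q ^ e"
      by (simp only: flip: power_mult power_add) (simp add: algebra_simps)
    then show ?thesis
      by (simp only: q_root power_one mult_1)
  qed
  then have "q ^ e = q ^ f"
    using eq by metis
  with \<open>e \<in> _\<close> \<open>f \<in> _\<close> show "e = f"
    using inj_onD[OF q_power_inj] by blast
qed

lemma prod_q_square: "(\<Prod>m<N. X - q ^ (2 * m) * Y) = X ^ N - Y ^ N"
proof -
  have "(q\<^sup>2) ^ N = (q ^ N)\<^sup>2"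
    by (simp only: power_mult[symmetric] mult.commute)
  also have "\<dots> = 1"
    by (simp only: q_root power_one)
  finally show ?thesis
    using prod_diff_roots_of_unity[OF _ _ q_square_power_inj, of X Y] by (simp add: power_mult)
qed

lemma q_powi:
  "q powi (2 * int i + 1) = q * q ^ (2 * i)" "q powi (2 * int i - 1) = q ^ (2 * l) * q ^ (2 * i)"
proof -
  have nat: "q powi (2 * int i) = q ^ (2 * i)"
    using power_int_of_nat[of q "2 * i"] by simp
  show "q powi (2 * int i + 1) = q * q ^ (2 * i)"
    using q_nonzero by (simp add: power_int_add_1 nat)
  have "inverse q = q ^ (2 * l)"
    using q_inverse by (simp add: inverse_unique)
  then show "q powi (2 * int i - 1) = q ^ (2 * l) * q ^ (2 * i)"
    using q_nonzero by (simp add: power_int_diff nat divide_inverse)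
qed

lemma node:
  assumes "r < M + M"
  shows "r div l < 2 * n" "2 * (r mod l) < N" "2 * (r mod l) + 1 < N"
proof -
  have "r mod l < l"
    using l_pos by simp
  then show "2 * (r mod l) < N" "2 * (r mod l) + 1 < N"
    by linarith+
  show "r div l < 2 * n"
    using assms by (simp add: less_mult_imp_div_less algebra_simps)
qed

lemma node_inj:
  assumes "r < M + M" "c < M + M" "u r = u c"
  shows "r = c"
proof -
  have "q ^ (2 * (r mod l)) * z (r div l) = q ^ (2 * (c mod l)) * z (c div l)"
    using assms(3) by (simp only: bar_def)
  from genericD[OF this node(1)[OF assms(1)] node(1)[OF assms(2)] node(2)[OF assms(1)] node(2)[OF assms(2)]]
  have "r div l = c div l \<and> r mod l = c mod l"
    by simp
  then show ?thesis
    by (metis div_mult_mod_eq)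
qed

text \<open>
  The exponents of \<open>q\<close> in \<open>u\<close> are even and at most \<open>2 l - 2\<close>. One more factor \<open>q\<close> makes such an
  exponent odd while it stays below \<open>2 l + 1\<close>, so the two sides cannot agree modulo the order.
\<close>
lemma node_not_q_multiple:
  assumes "r < M + M" "c < M + M"
  shows "u r \<noteq> q * u c"
proof
  assume "u r = q * u c"
  then have "q ^ (2 * (r mod l)) * z (r div l) = q ^ (2 * (c mod l) + 1) * z (c div l)"
    by (simp add: bar_def mult.assoc)
  from genericD[OF this node(1)[OF assms(1)] node(1)[OF assms(2)] node(2)[OF assms(1)] node(3)[OF assms(2)]]
  have "2 * (r mod l) = 2 * (c mod l) + 1" ..
  from arg_cong[OF this, of even] show False
    by simp
qed

lemma node_not_inverse_multiple:
  assumes "r < M + M" "c < M + M"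
  shows "u r \<noteq> q ^ (2 * l) * u c"
proof
  assume "u r = q ^ (2 * l) * u c"
  then have "q * u r = (q * q ^ (2 * l)) * u c"
    by (simp only: mult.assoc)
  then have "u c = q * u r"
    by (simp only: q_inverse mult_1)
  with node_not_q_multiple[OF assms(2,1)] show False
    by blast
qed

lemma weight_denominator_sym:
  "(X - q * Y) * (X - q ^ (2 * l) * Y) = (Y - q * X) * (Y - q ^ (2 * l) * X)"
proof -
  have expand: "(X - q * Y) * (X - q ^ (2 * l) * Y) =
      X * X + (q * q ^ (2 * l)) * (Y * Y) - (q + q ^ (2 * l)) * (X * Y)" for X Y
    by (simp only: algebra_simps)
  show ?thesis
    by (simp only: expand q_inverse mult.commute[of X Y]) simp
qed

lemma weight_sym: "wt X Y = wt Y X"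
  unfolding six_vertex_weight_def by (simp only: weight_denominator_sym)

text \<open>The polynomial \<open>P\<close> whose roots are the \<open>N\<close>-th powers of the \<open>x\<close>'s.\<close>
definition node_poly :: "'a poly" where
  "node_poly = (\<Prod>b<n. [:- (z b ^ N), 1:])"

lemma poly_node_poly: "poly node_poly t = (\<Prod>b<n. t - z b ^ N)"
  by (simp add: node_poly_def poly_prod del: power_Suc)

lemma degree_node_poly: "degree node_poly = n"
  by (simp add: node_poly_def degree_prod_sum_eq)

lemma coeff_node_poly: "coeff node_poly n = 1"
proof -
  have "lead_coeff node_poly = 1"
    unfolding node_poly_def lead_coeff_prod by (intro prod.neutral) simp
  then show ?thesis
    by (simp only: degree_node_poly)
qed

lemma node_pow: "u r ^ N = z (r div l) ^ N"
proof -
  have "(q ^ (2 * (r mod l))) ^ N = (q ^ N) ^ (2 * (r mod l))"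
    by (simp only: power_mult[symmetric] mult.commute)
  then show ?thesis
    by (simp only: bar_def power_mult_distrib q_root power_one mult_1)
qed

lemma node_poly_zero:
  assumes "r < M"
  shows "poly node_poly (u r ^ N) = 0"
proof -
  have "r div l < n"
    using assms by (simp add: less_mult_imp_div_less mult.commute)
  then show ?thesis
    unfolding poly_node_poly node_pow by (intro prod_zero bexI[of _ "r div l"]) simp_all
qed

abbreviation "K \<equiv> bezout_kernel n l q (coeff node_poly)"

lemma kernel_identity:
  "(Y - q * X) * (Y - q ^ (2 * l) * X) * K Y X =
    (q - q ^ (2 * l)) * (poly node_poly (Y ^ N) - poly node_poly (X ^ N))"
  using bezout_kernel_identity[OF n_pos l_pos q_root, of Y X "coeff node_poly"]
  by (simp only: poly_altdef degree_node_poly)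

lemma kernel_eq_weight:
  assumes "r < M + M" "c < M + M"
  shows "K (u r) (u c) =
    (q - q ^ (2 * l)) * (poly node_poly (u r ^ N) - poly node_poly (u c ^ N)) * wt (u r) (u c)"
proof -
  have "(u r - q * u c) * (u r - q ^ (2 * l) * u c) \<noteq> 0"
    using node_not_q_multiple[OF assms] node_not_inverse_multiple[OF assms] by simp
  then show ?thesis
    unfolding kernel_identity[of "u r" "u c", symmetric] six_vertex_weight_def by simp
qed

definition alternant_mat :: "'a mat" where
  "alternant_mat = mat (M + M) (M + M) (\<lambda>(r, c). u r ^ expo l c)"

definition weight_mat :: "'a mat" where
  "weight_mat = mat M M (\<lambda>(r, c). wt (u r) (u (M + c)))"

lemma alternant_mat_congruence:
  fixes p :: "nat \<Rightarrow> nat"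
  defines "\<Omega> \<equiv> mat (2 * l * n) (2 * l * n) (\<lambda>(c, d). bezout_form n l q (coeff node_poly) c d)"
    and "V' \<equiv> mat (M + M) (M + M) (\<lambda>(r, c). u (p r) ^ expo l c)"
  shows "alternant_mat * \<Omega> * transpose_mat V' = mat (M + M) (M + M) (\<lambda>(r, c). K (u r) (u (p c)))"
proof -
  have M: "2 * l * n = M + M"
    by simp
  show ?thesis
  proof (rule eq_matI)
    fix i j
    assume "i < dim_row (mat (M + M) (M + M) (\<lambda>(r, c). K (u r) (u (p c))))"
      and "j < dim_col (mat (M + M) (M + M) (\<lambda>(r, c). K (u r) (u (p c))))"
    then have ij: "i < M + M" "j < M + M"
      by simp_all
    have "(alternant_mat * \<Omega> * transpose_mat V') $$ (i, j) =
        (\<Sum>d<M + M. (\<Sum>c<M + M. u i ^ expo l c * bezout_form n l q (coeff node_poly) c d) *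
          u (p j) ^ expo l d)"
      using ij
      by (simp add: alternant_mat_def \<Omega>_def V'_def scalar_prod_def M atLeast0LessThan
          del: mult_2 mult_2_right)
    also have "\<dots> = K (u i) (u (p j))"
      unfolding bezout_kernel_def M sum_distrib_right by (rule sum.swap)
    finally show "(alternant_mat * \<Omega> * transpose_mat V') $$ (i, j) =
        mat (M + M) (M + M) (\<lambda>(r, c). K (u r) (u (p c))) $$ (i, j)"
      using ij by simp
  qed (simp_all add: alternant_mat_def V'_def)
qed

text \<open>
  The alternant matrix is multiplied by \<open>bezout_form\<close> and by the transpose of the alternant matrix
  with the \<open>x\<close>-rows and \<open>y\<close>-rows exchanged. The exchange moves the vanishing \<open>x\<close>-\<open>x\<close> block to the
  upper right corner, and the two diagonal blocks are the weight matrix and its transpose with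
  scaled columns and rows.
\<close>
lemma weight_det_square:
  "\<exists>\<epsilon>\<in>{1, -1}. ((q - q ^ (2 * l)) ^ M * (\<Prod>c<M. poly node_poly (u (M + c) ^ N)) * det weight_mat)\<^sup>2 =
    \<epsilon> * (\<Prod>d<2 * l * n. q ^ (d mod (2 * l) + 1) - q ^ (2 * l - d mod (2 * l))) * (det alternant_mat)\<^sup>2"
proof -
  define \<Omega> where
    "\<Omega> = mat (2 * l * n) (2 * l * n) (\<lambda>(c, d). bezout_form n l q (coeff node_poly) c d)"
  define p where "p r = (if r < M then r + M else r - M)" for r
  define V' where "V' = mat (M + M) (M + M) (\<lambda>(r, c). u (p r) ^ expo l c)"
  define \<gamma> where "\<gamma> = q - q ^ (2 * l)"
  define P where "P c = poly node_poly (u (M + c) ^ N)" for c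
  define A where "A = \<gamma> ^ M * (\<Prod>c<M. P c) * det weight_mat"
  define \<kappa> where "\<kappa> = (\<Prod>d<2 * l * n. q ^ (d mod (2 * l) + 1) - q ^ (2 * l - d mod (2 * l)))"
  have M2: "2 * l * n = M + M"
    by simp
  have V: "alternant_mat \<in> carrier_mat (M + M) (M + M)"
    "V' \<in> carrier_mat (M + M) (M + M)" "\<Omega> \<in> carrier_mat (M + M) (M + M)"
    unfolding alternant_mat_def V'_def \<Omega>_def M2 by (rule mat_carrier)+
  have W: "weight_mat \<in> carrier_mat M M"
    unfolding weight_mat_def by (rule mat_carrier)
  have K_xx: "K (u r) (u c) = 0" if "r < M" "c < M" for r c
    using that by (simp add: kernel_eq_weight node_poly_zero del: power_Suc One_nat_def)
  have K_xy: "K (u r) (u (M + c)) = 1 * (- \<gamma> * P c) * wt (u r) (u (M + c))" if "r < M" "c < M" for r c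
    using that by (simp add: kernel_eq_weight node_poly_zero \<gamma>_def P_def del: power_Suc One_nat_def minus_diff_eq)
  have K_yx: "K (u (M + r)) (u c) = \<gamma> * P r * 1 * wt (u c) (u (M + r))" if "r < M" "c < M" for r c
    using that weight_sym[of "u (M + r)" "u c"]
    by (simp add: kernel_eq_weight node_poly_zero \<gamma>_def P_def del: power_Suc One_nat_def)
  let ?XY = "mat M M (\<lambda>(r, c). K (u r) (u (M + c)))"
  let ?YY = "mat M M (\<lambda>(r, c). K (u (M + r)) (u (M + c)))"
  let ?YX = "mat M M (\<lambda>(r, c). K (u (M + r)) (u c))"
  have "alternant_mat * \<Omega> * transpose_mat V' =
      mat (M + M) (M + M) (\<lambda>(r, c). K (u r) (u (p c)))"
    unfolding \<Omega>_def V'_def by (rule alternant_mat_congruence)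
  also have "\<dots> = four_block_mat ?XY (0\<^sub>m M M) ?YY ?YX"
    by (rule eq_matI) (auto simp: p_def K_xx add.commute)
  finally have "det (alternant_mat * \<Omega> * transpose_mat V') = det ?XY * det ?YX"
    by (simp add: det_four_block_mat_upper_right_zero[of _ M _ M])
  moreover have "det (alternant_mat * \<Omega> * transpose_mat V') = det alternant_mat * det \<Omega> * det V'"
    using V by (simp only: det_mult[of _ "M + M"] det_transpose[of _ "M + M"] mult_carrier_mat[of _ "M + M" "M + M" _ "M + M"] transpose_carrier_mat)
  moreover have "det V' = (- 1) ^ (M * M) * det alternant_mat"
  proof -
    have "mat (M + M) (M + M)
        (\<lambda>(i, j). alternant_mat $$ (if i < M then i + M else i - M, j)) = V'"
      by (rule eq_matI) (auto simp: V'_def p_def alternant_mat_def)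
    with det_swap_rows[OF V(1)] have "det alternant_mat = (- 1) ^ (M * M) * det V'"
      by simp
    then have "(- 1) ^ (M * M) * det alternant_mat =
        ((- 1) ^ (M * M) * (- 1) ^ (M * M)) * det V'"
      by (simp only: mult.assoc)
    then show ?thesis
      by (simp flip: power_mult_distrib)
  qed
  moreover obtain \<epsilon> where \<epsilon>: "\<epsilon> \<in> {1, -1}" "det \<Omega> = \<epsilon> * \<kappa>"
    using det_bezout_form[of l "coeff node_poly" n q, OF l_pos coeff_node_poly] unfolding \<Omega>_def \<kappa>_def by blast
  moreover have "det ?XY = (- 1) ^ M * A"
  proof -
    have "?XY = mat M M (\<lambda>(r, c). 1 * (- \<gamma> * P c) * wt (u r) (u (M + c)))"
      by (rule eq_matI) (simp_all add: K_xy)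
    then have "det ?XY = (\<Prod>r<M. 1) * (\<Prod>c<M. - \<gamma> * P c) * det weight_mat"
      by (simp only: det_scale weight_mat_def)
    then show ?thesis
      by (simp add: A_def prod.distrib power_minus[of \<gamma>] mult.assoc prod_uminus)
  qed
  moreover have "det ?YX = A"
  proof -
    have "?YX = mat M M (\<lambda>(r, c). \<gamma> * P r * 1 * wt (u c) (u (M + r)))"
      by (rule eq_matI) (simp_all add: K_yx)
    then have "det ?YX = (\<Prod>r<M. \<gamma> * P r) * (\<Prod>c<M. 1) * det (mat M M (\<lambda>(r, c). wt (u c) (u (M + r))))"
      by (simp only: det_scale)
    moreover have "mat M M (\<lambda>(r, c). wt (u c) (u (M + r))) = transpose_mat weight_mat"
      by (rule eq_matI) (simp_all add: weight_mat_def)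
    ultimately show ?thesis
      by (simp add: A_def prod.distrib det_transpose[OF W])
  qed
  ultimately have "(- 1) ^ M * A * A = det alternant_mat * (\<epsilon> * \<kappa>) * ((- 1) ^ (M * M) * det alternant_mat)"
    by simp
  then have signed: "(- 1) ^ M * A * A =
      (- 1) ^ (M * M) * \<epsilon> * \<kappa> * (det alternant_mat)\<^sup>2"
    by (simp only: power2_eq_square mult_ac)
  have "A\<^sup>2 = ((- 1) ^ M * (- 1) ^ M) * (A * A)"
    by (simp add: power2_eq_square flip: power_mult_distrib)
  also have "\<dots> = (- 1) ^ M * ((- 1) ^ M * A * A)"
    by (simp only: mult.assoc)
  also have "\<dots> = (- 1) ^ M * (- 1) ^ (M * M) * \<epsilon> * \<kappa> * (det alternant_mat)\<^sup>2"
    unfolding signed by (simp only: mult.assoc)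
  finally have "A\<^sup>2 = (- 1) ^ M * (- 1) ^ (M * M) * \<epsilon> * \<kappa> * (det alternant_mat)\<^sup>2" .
  moreover have "(- 1) ^ M * (- 1) ^ (M * M) * \<epsilon> \<in> {1, -1}"
    using \<epsilon>(1) by (cases "even M") auto
  ultimately show ?thesis
    unfolding A_def \<gamma>_def P_def \<kappa>_def by blast
qed

text \<open>
  Within each block \<open>A_mat\<close> is the transpose of \<open>weight_mat\<close>: its row index goes with \<open>y\<close> and its
  column index with \<open>x\<close>, although block rows belong to \<open>x\<close>. The determinant is still the same.
  The weight is homogeneous, so within a block it depends on the two positions through their
  difference, up to factors attached to rows and columns. Reversing the positions in every block
  (the permutation \<open>\<tau>\<close>) thus transposes all blocks at once, up to the scaling \<open>d\<close> of rows and
  columns, and the scaling factors at \<open>r\<close> and \<open>\<tau> r\<close> are inverse to each other.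
\<close>
lemma det_A_mat: "det (A_mat n l q z (\<lambda>j. z (n + j))) = det weight_mat"
proof -
  define \<tau> where "\<tau> r = (if r < M then (r div l) * l + (l - 1 - r mod l) else r)" for r
  define d where "d r = q ^ (2 * (l - 1)) / q ^ (4 * (r mod l))" for r
  define W where "W r c = wt (u r) (u (M + c))" for r c
  have \<tau>_divmod: "\<tau> r div l = r div l" "\<tau> r mod l = l - 1 - r mod l" if "r < M" for r
    using that l_pos by (simp_all add: \<tau>_def)
  have \<tau>_less: "\<tau> r < M" if "r < M" for r
  proof -
    have "r div l < n"
      using that by (simp add: less_mult_imp_div_less mult.commute)
    moreover have "l - 1 - r mod l < l"
      using l_pos by linarith
    ultimately show ?thesis
      using that by (simp only: \<tau>_def if_True index_mult_add_less)
  qed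
  have \<tau>_\<tau>: "\<tau> (\<tau> r) = r" for r
  proof (cases "r < M")
    case True
    have "l - 1 - (l - 1 - r mod l) = r mod l"
      using l_pos mod_less_divisor[of l r] by linarith
    then have "\<tau> (\<tau> r) = r div l * l + r mod l"
      using \<tau>_less[OF True] by (simp only: \<tau>_def[of "\<tau> r"] \<tau>_divmod[OF True] if_True)
    then show ?thesis by simp
  qed (simp add: \<tau>_def)
  have \<tau>: "\<tau> permutes {0..<M}"
    by (rule bij_imp_permutes, rule bij_betw_byWitness[of _ \<tau>]) (use \<tau>_less in \<open>auto simp: \<tau>_\<tau>\<close>, simp add: \<tau>_def)
  have d_\<tau>: "d r * d (\<tau> r) = 1" if "r < M" for r
  proof -
    have "r mod l + (l - 1 - r mod l) = l - 1"
      using l_pos mod_less_divisor[of l r] by linarith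
    then have "4 * (r mod l) + 4 * (l - 1 - r mod l) = 2 * (l - 1) + 2 * (l - 1)"
      by linarith
    then have "q ^ (4 * (r mod l)) * q ^ (4 * (l - 1 - r mod l)) = q ^ (2 * (l - 1)) * q ^ (2 * (l - 1))"
      by (simp only: flip: power_add)
    then show ?thesis
      using q_nonzero by (simp add: d_def \<tau>_divmod[OF that] del: One_nat_def)
  qed
  have entry: "A_mat n l q z (\<lambda>j. z (n + j)) $$ (r, c) = d r * d c * W (\<tau> r) (\<tau> c)"
    if "r < M" "c < M" for r c
  proof -
    define i j where "i = r mod l" and "j = c mod l"
    define X Y where "X = z (r div l)" and "Y = z (n + c div l)"
    have ij: "i < l" "j < l"
      using l_pos by (simp_all add: i_def j_def)
    have homog: "wt (g * x) (g * y) * g\<^sup>2 = wt x y" if "g \<noteq> 0" for g x y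
    proof -
      have "(g * x - q * (g * y)) * (g * x - q ^ (2 * l) * (g * y)) =
          g\<^sup>2 * ((x - q * y) * (x - q ^ (2 * l) * y))"
        by (simp add: power2_eq_square algebra_simps)
      then show ?thesis
        using that by (simp add: six_vertex_weight_def)
    qed
    let ?g = "q ^ (2 * (i + j))" and ?h = "q ^ (2 * (l - 1))"
    have exps: "2 * (i + j) + 2 * (l - 1 - i) = 2 * (l - 1) + 2 * j"
      "2 * (i + j) + 2 * (l - 1 - j) = 2 * (l - 1) + 2 * i"
      using ij by simp_all
    have args: "?g * (q ^ (2 * (l - 1 - i)) * X) = ?h * (q ^ (2 * j) * X)"
      "?g * (q ^ (2 * (l - 1 - j)) * Y) = ?h * (q ^ (2 * i) * Y)"
      unfolding mult.assoc[symmetric] power_add[symmetric] exps by (rule refl)+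
    have "A_mat n l q z (\<lambda>j. z (n + j)) $$ (r, c) = A_entry q X Y i j"
      using that by (simp add: A_mat_def i_def j_def X_def Y_def)
    also have "\<dots> = wt (q ^ (2 * j) * X) (q ^ (2 * i) * Y)"
      unfolding A_entry_def q_powi six_vertex_weight_def by (simp only: mult_ac)
    also have "\<dots> = wt (?g * (q ^ (2 * (l - 1 - i)) * X)) (?g * (q ^ (2 * (l - 1 - j)) * Y)) * ?h\<^sup>2"
      unfolding args by (rule homog[symmetric]) (simp add: q_nonzero)
    also have "\<dots> = wt (q ^ (2 * (l - 1 - i)) * X) (q ^ (2 * (l - 1 - j)) * Y) * (?h\<^sup>2 / ?g\<^sup>2)"
    proof -
      have "a * h = b * (h / g)" if "a * g = b" "g \<noteq> 0" for a b g h :: 'a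
        using that by auto
      note rescale = this
      show ?thesis
        by (rule rescale[OF homog]) (simp_all add: q_nonzero)
    qed
    also have "?h\<^sup>2 / ?g\<^sup>2 = d r * d c"
    proof -
      have "?g\<^sup>2 = q ^ (4 * i) * q ^ (4 * j)"
        by (simp only: flip: power_mult power_add) (simp add: algebra_simps)
      then show ?thesis
        by (simp only: d_def i_def j_def power2_eq_square times_divide_times_eq)
    qed
    also have "wt (q ^ (2 * (l - 1 - i)) * X) (q ^ (2 * (l - 1 - j)) * Y) = W (\<tau> r) (\<tau> c)"
    proof -
      have "(M + \<tau> c) div l = n + c div l" "(M + \<tau> c) mod l = l - 1 - j"
        using l_pos \<tau>_divmod[OF that(2)] by (simp_all add: j_def)
      then show ?thesis
        by (simp only: W_def bar_def \<tau>_divmod[OF that(1)] X_def Y_def i_def)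
    qed
    finally show ?thesis
      by (simp only: mult.commute)
  qed
  have "A_mat n l q z (\<lambda>j. z (n + j)) = mat M M (\<lambda>(r, c). d r * d c * W (\<tau> r) (\<tau> c))"
    by (rule eq_matI) (simp add: entry, simp_all add: A_mat_def)
  then have "det (A_mat n l q z (\<lambda>j. z (n + j))) =
      (\<Prod>r<M. d r) * (\<Prod>c<M. d c) * det (mat M M (\<lambda>(r, c). W (\<tau> r) (\<tau> c)))"
    by (simp only: det_scale)
  also have "det (mat M M (\<lambda>(r, c). W (\<tau> r) (\<tau> c))) = det weight_mat"
    using det_relabel[OF \<tau>, of W] by (simp only: weight_mat_def W_def)
  also have "(\<Prod>r<M. d r) * (\<Prod>c<M. d c) = (\<Prod>r<M. d r * d (\<tau> r))"
    using prod.permute[OF \<tau>, of d] by (simp add: prod.distrib atLeast0LessThan comp_def)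
  also have "\<dots> = 1"
    by (intro prod.neutral) (simp add: d_\<tau>)
  finally show ?thesis
    by simp
qed

text \<open>
  For fixed \<open>X\<close> and \<open>y\<close>, the differences of \<open>X\<close> and the \<open>q ^ (2 p) y\<close> with \<open>p < l\<close> come from the
  Vandermonde determinant, and those with \<open>l \<le> p < N\<close> are the factors of the prefactor, because
  \<open>q ^ (2 p - 1) = q ^ (2 (l + p))\<close>. Together they make up \<open>X ^ N - y ^ N\<close>. Squares remove the
  sign from exchanging the roles of \<open>x\<close> and \<open>y\<close> in the last difference.
\<close>
lemma prefactor_square:
  "((\<Prod>i<n. \<Prod>j<n. \<Prod>p\<le>l. \<Prod>k<l. q ^ (2 * k) * z i - q powi (2 * int p - 1) * z (n + j)) *
     (\<Prod>r<M. \<Prod>c<M. u r - u (M + c)))\<^sup>2 = (\<Prod>c<M. poly node_poly (u (M + c) ^ N))\<^sup>2"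
proof -
  define R where "R i j k p = q ^ (2 * k) * z i - q ^ (2 * p) * z (n + j)" for i j k p
  have divmod: "(m * l + r) div l = m" "(m * l + r) mod l = r" if "r < l" for m r
    using that by auto
  have u1: "u (m * l + k) = q ^ (2 * k) * z m" if "k < l" for m k
    by (simp only: bar_def divmod[OF that])
  have u2: "u (M + (m * l + k)) = q ^ (2 * k) * z (n + m)" if "k < l" for m k
  proof -
    have "M + (m * l + k) = (n + m) * l + k"
      by (simp add: algebra_simps)
    then show ?thesis
      by (simp only: u1[OF that])
  qed
  have low: "(\<Prod>r<M. \<Prod>c<M. u r - u (M + c)) = (\<Prod>i<n. \<Prod>j<n. \<Prod>k<l. \<Prod>p<l. R i j k p)"
  proof -
    have "(\<Prod>r<M. \<Prod>c<M. u r - u (M + c)) = (\<Prod>i<n. \<Prod>k<l. \<Prod>j<n. \<Prod>p<l. R i j k p)"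
      unfolding prod.lessThan_mult R_def
      by (intro prod.cong refl) (simp only: u1 u2 lessThan_iff)
    also have "\<dots> = (\<Prod>i<n. \<Prod>j<n. \<Prod>k<l. \<Prod>p<l. R i j k p)"
      by (rule prod.cong[OF refl], rule prod.swap)
    finally show ?thesis .
  qed
  have high: "(\<Prod>p\<le>l. \<Prod>k<l. q ^ (2 * k) * z i - q powi (2 * int p - 1) * z (n + j)) =
      (\<Prod>k<l. \<Prod>p\<in>{l..<N}. R i j k p)" for i j
  proof -
    have "(\<Prod>p\<le>l. \<Prod>k<l. q ^ (2 * k) * z i - q powi (2 * int p - 1) * z (n + j)) =
        (\<Prod>p\<le>l. \<Prod>k<l. R i j k (l + p))"
      by (simp add: q_powi R_def power_add distrib_left)
    also have "\<dots> = (\<Prod>k<l. \<Prod>p\<le>l. R i j k (l + p))"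
      by (rule prod.swap)
    also have "\<dots> = (\<Prod>k<l. \<Prod>p\<in>{l..<N}. R i j k p)"
      by (intro prod.cong refl prod.reindex_bij_witness[of _ "\<lambda>p. p - l" "\<lambda>p. l + p"]) auto
    finally show ?thesis .
  qed
  have full: "(\<Prod>p\<in>{l..<N}. R i j k p) * (\<Prod>p<l. R i j k p) = z i ^ N - z (n + j) ^ N" for i j k
  proof -
    have "{..<N} = {l..<N} \<union> {..<l}"
      by auto
    moreover have "{l..<N} \<inter> {..<l} = {}"
      by auto
    ultimately have "(\<Prod>p\<in>{l..<N}. R i j k p) * (\<Prod>p<l. R i j k p) = (\<Prod>p<N. R i j k p)"
      by (simp only: prod.union_disjoint finite_atLeastLessThan finite_lessThan)
    also have "\<dots> = (q ^ (2 * k) * z i) ^ N - z (n + j) ^ N"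
      unfolding R_def by (rule prod_q_square)
    also have "(q ^ (2 * k)) ^ N = (q ^ N) ^ (2 * k)"
      by (simp only: power_mult[symmetric] mult.commute)
    then have "(q ^ (2 * k) * z i) ^ N = z i ^ N"
      by (simp only: power_mult_distrib q_root power_one mult_1)
    finally show ?thesis .
  qed
  have "(\<Prod>i<n. \<Prod>j<n. \<Prod>p\<le>l. \<Prod>k<l. q ^ (2 * k) * z i - q powi (2 * int p - 1) * z (n + j)) *
     (\<Prod>r<M. \<Prod>c<M. u r - u (M + c)) = (\<Prod>i<n. \<Prod>j<n. \<Prod>k<l. (\<Prod>p\<in>{l..<N}. R i j k p) * (\<Prod>p<l. R i j k p))"
    unfolding low high by (simp only: prod.distrib)
  also have "\<dots> = (\<Prod>i<n. \<Prod>j<n. \<Prod>k<l. z i ^ N - z (n + j) ^ N)"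
    by (intro prod.cong refl full)
  finally have lhs: "(\<Prod>i<n. \<Prod>j<n. \<Prod>p\<le>l. \<Prod>k<l. q ^ (2 * k) * z i - q powi (2 * int p - 1) * z (n + j)) *
     (\<Prod>r<M. \<Prod>c<M. u r - u (M + c)) = (\<Prod>i<n. \<Prod>j<n. \<Prod>k<l. z i ^ N - z (n + j) ^ N)" .
  have "(M + (m * l + k)) div l = n + m" if "k < l" for m k
  proof -
    have "M + (m * l + k) = (n + m) * l + k"
      by (simp add: algebra_simps)
    then show ?thesis
      by (simp only: divmod[OF that])
  qed
  then have "(\<Prod>c<M. poly node_poly (u (M + c) ^ N)) =
      (\<Prod>j<n. \<Prod>k<l. \<Prod>i<n. z (n + j) ^ N - z i ^ N)"
    unfolding prod.lessThan_mult poly_node_poly node_pow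
    by (intro prod.cong refl) (simp only: lessThan_iff)
  also have "\<dots> = (\<Prod>j<n. \<Prod>i<n. \<Prod>k<l. z (n + j) ^ N - z i ^ N)"
    by (rule prod.cong[OF refl], rule prod.swap)
  also have "\<dots> = (\<Prod>i<n. \<Prod>j<n. \<Prod>k<l. z (n + j) ^ N - z i ^ N)"
    by (rule prod.swap)
  finally have rhs: "(\<Prod>c<M. poly node_poly (u (M + c) ^ N)) =
      (\<Prod>i<n. \<Prod>j<n. \<Prod>k<l. z (n + j) ^ N - z i ^ N)" .
  show ?thesis
    unfolding lhs rhs prod_power_distrib by (intro prod.cong refl power2_commute)
qed

lemma vandermonde_nonzero: "vandermonde (M + M) u \<noteq> 0"
proof -
  have "u i - u j \<noteq> 0" if "i < M + M" "j \<in> {i<..<M + M}" for i j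
    using node_inj[of i j] that by auto
  then show ?thesis
    unfolding vandermonde_def by auto
qed

lemma partition_fn_square:
  "\<exists>\<epsilon>\<in>{1, -1}. (q - q ^ (2 * l)) ^ (2 * M) *
      (partition_fn n l q z (\<lambda>j. z (n + j)) * vandermonde (M + M) u)\<^sup>2 =
    \<epsilon> * (\<Prod>d<2 * l * n. q ^ (d mod (2 * l) + 1) - q ^ (2 * l - d mod (2 * l))) * (det alternant_mat)\<^sup>2"
proof -
  define F where "F = (\<Prod>i<n. \<Prod>j<n. \<Prod>p\<le>l. \<Prod>k<l. q ^ (2 * k) * z i - q powi (2 * int p - 1) * z (n + j))"
  define R where "R = (\<Prod>r<M. \<Prod>c<M. u r - u (M + c))"
  have bar_y: "bar l q (\<lambda>j. z (n + j)) = (\<lambda>r. u (M + r))"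
    using l_pos by (auto simp: bar_def)
  have split: "vandermonde (M + M) u = vandermonde M u * vandermonde M (\<lambda>r. u (M + r)) * R"
    unfolding R_def by (rule vandermonde_append)
  have nz: "vandermonde M u \<noteq> 0" "vandermonde M (\<lambda>r. u (M + r)) \<noteq> 0"
    using vandermonde_nonzero unfolding split by auto
  have "partition_fn n l q z (\<lambda>j. z (n + j)) * vandermonde (M + M) u = F * R * det weight_mat"
    unfolding partition_fn_def F_def[symmetric] det_A_mat split bar_y using nz by simp
  then have "(q - q ^ (2 * l)) ^ (2 * M) * (partition_fn n l q z (\<lambda>j. z (n + j)) * vandermonde (M + M) u)\<^sup>2 =
      ((q - q ^ (2 * l)) ^ M)\<^sup>2 * (F * R)\<^sup>2 * (det weight_mat)\<^sup>2"
    by (simp add: power_mult_distrib mult.commute[of 2] power_mult mult_ac)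
  also have "(F * R)\<^sup>2 = (\<Prod>c<M. poly node_poly (u (M + c) ^ N))\<^sup>2"
    unfolding F_def R_def by (rule prefactor_square)
  finally have "(q - q ^ (2 * l)) ^ (2 * M) * (partition_fn n l q z (\<lambda>j. z (n + j)) * vandermonde (M + M) u)\<^sup>2 =
      ((q - q ^ (2 * l)) ^ M * (\<Prod>c<M. poly node_poly (u (M + c) ^ N)) * det weight_mat)\<^sup>2"
    by (simp only: power_mult_distrib)
  then show ?thesis
    using weight_det_square by simp
qed

end

section \<open>Variables, constants and permutations of polynomials\<close>

lemma mvars_add: "mvars (P + Q) \<subseteq> mvars P \<union> mvars (Q :: 'a::comm_ring_1 mpol)"
  using Poly_Mapping.keys_add[of P Q] by (auto simp: mvars_def)

lemma mvars_mult: "mvars (P * Q) \<subseteq> mvars P \<union> mvars (Q :: 'a::comm_ring_1 mpol)"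
proof
  fix i assume "i \<in> mvars (P * Q)"
  then obtain m where "m \<in> Poly_Mapping.keys (P * Q)" "i \<in> Poly_Mapping.keys m"
    by (auto simp: mvars_def)
  moreover then obtain a b where "m = a + b" "a \<in> Poly_Mapping.keys P" "b \<in> Poly_Mapping.keys Q"
    using Poly_Mapping.keys_mult[of P Q] by blast
  ultimately show "i \<in> mvars P \<union> mvars Q"
    using Poly_Mapping.keys_add[of a b] by (auto simp: mvars_def)
qed

lemma mvars_0: "mvars 0 = {}"
  by (simp add: mvars_def)

lemma mvars_mconst: "mvars (mconst c) = {}"
  by (simp add: mvars_def mconst_def)

lemma mvars_mvar: "mvars (mvar i :: 'a::comm_ring_1 mpol) = {i}"
  by (simp add: mvars_def mvar_def)

lemma mconst_1: "mconst 1 = 1"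
  by (simp add: mconst_def)

lemma mvars_1: "mvars (1 :: 'a::comm_ring_1 mpol) = {}"
  unfolding mconst_1[symmetric] by (rule mvars_mconst)

lemma mvars_uminus: "mvars (- P) = mvars (P :: 'a::comm_ring_1 mpol)"
  by (simp add: mvars_def)

lemma mvars_sum:
  "(\<And>i. i \<in> I \<Longrightarrow> mvars (f i) \<subseteq> A) \<Longrightarrow> mvars (\<Sum>i\<in>I. f i :: 'a::comm_ring_1 mpol) \<subseteq> A"
proof (induction I rule: infinite_finite_induct)
  case (insert i I)
  then show ?case
    using mvars_add[of "f i" "sum f I"] by auto
qed (simp_all add: mvars_0)

lemma mvars_prod:
  "(\<And>i. i \<in> I \<Longrightarrow> mvars (f i) \<subseteq> A) \<Longrightarrow> mvars (\<Prod>i\<in>I. f i :: 'a::comm_ring_1 mpol) \<subseteq> A"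
proof (induction I rule: infinite_finite_induct)
  case (insert i I)
  then show ?case
    using mvars_mult[of "f i" "prod f I"] by auto
qed (simp_all add: mvars_1)

lemma mvars_det:
  fixes F :: "nat \<Rightarrow> nat \<Rightarrow> 'a::comm_ring_1 mpol"
  assumes "\<And>i j. i < m \<Longrightarrow> j < m \<Longrightarrow> mvars (F i j) \<subseteq> A"
  shows "mvars (det (mat m m (\<lambda>(i, j). F i j))) \<subseteq> A"
  unfolding det_def'[OF mat_carrier]
proof (rule mvars_sum)
  fix p assume "p \<in> {p. p permutes {0..<m}}"
  then have p: "p permutes {0..<m}"
    by simp
  have "mvars (\<Prod>i = 0..<m. mat m m (\<lambda>(i, j). F i j) $$ (i, p i)) \<subseteq> A"
    using permutes_in_image[OF p] by (intro mvars_prod) (auto dest!: subsetD[OF assms, rotated 2])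
  then show "mvars (signof p * (\<Prod>i = 0..<m. mat m m (\<lambda>(i, j). F i j) $$ (i, p i))) \<subseteq> A"
    by (simp add: sign_def mvars_uminus)
qed

lemma mvars_divided_power:
  fixes u :: "nat \<Rightarrow> 'a::comm_ring_1 mpol"
  assumes "\<And>i. i \<le> j \<Longrightarrow> mvars (u i) \<subseteq> A"
  shows "mvars (divided_power u j k) \<subseteq> A"
  using assms
proof (induction u j k rule: divided_power.induct)
  case (2 u k)
  then show ?case
    using mvars_mult[of "u 0" "divided_power u 0 k"] by auto
next
  case (4 u j k)
  then have "mvars (divided_power u j k) \<subseteq> A" "mvars (divided_power u (Suc j) k) \<subseteq> A"
    "mvars (u (Suc j)) \<subseteq> A"
    by auto
  then show ?case
    unfolding divided_power.simps
    by (intro order.trans[OF mvars_add] order.trans[OF mvars_mult] Un_least)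
qed (simp_all add: mvars_0 mvars_1)

lemma mvars_alternant_quotient:
  fixes u :: "nat \<Rightarrow> 'a::comm_ring_1 mpol"
  assumes "\<And>i. i < m \<Longrightarrow> mvars (u i) \<subseteq> A"
  shows "mvars (alternant_quotient m e u) \<subseteq> A"
  unfolding alternant_quotient_def
  using assms by (intro mvars_det mvars_divided_power) auto

lemma mconst_mult_mvar: "mconst c * mvar i = Poly_Mapping.single (Poly_Mapping.single i 1) c"
  for c :: "'a::comm_ring_1"
  by (simp add: mconst_def mvar_def mult_single)

lemma mconst_mult_mvar_eq_iff:
  fixes c d :: "'a::comm_ring_1"
  assumes "c \<noteq> 0"
  shows "mconst c * mvar i = mconst d * mvar j \<longleftrightarrow> c = d \<and> i = j"
proof
  assume "mconst c * mvar i = mconst d * mvar j"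
  then have eq: "Poly_Mapping.single (Poly_Mapping.single i (1::nat)) c = Poly_Mapping.single (Poly_Mapping.single j 1) d"
    by (simp only: mconst_mult_mvar)
  then have "Poly_Mapping.single i (1::nat) = Poly_Mapping.single j 1"
    using assms by (metis keys_single lookup_single_eq lookup_single_not_eq)
  moreover then have "i = j"
    by (metis lookup_single_eq lookup_single_not_eq zero_neq_one)
  ultimately show "c = d \<and> i = j"
    using eq by (metis lookup_single_eq)
qed simp

lemma comm_ring_hom_mconst: "comm_ring_hom (mconst :: 'a::comm_ring_1 \<Rightarrow> _)"
  by standard (simp_all add: mconst_def single_add mult_single)

text \<open>
  On monomials \<open>mpermute\<close> acts through an additive map of exponent vectors, so multiplicativity
  follows by expanding both factors into monomials.
\<close>
lemma comm_ring_hom_mpermute: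
  assumes \<pi>: "\<pi> permutes A"
  shows "comm_ring_hom (mpermute \<pi> :: 'a::comm_ring_1 mpol \<Rightarrow> _)"
proof -
  define \<phi> where "\<phi> = (Poly_Mapping.map_key (inv_into UNIV \<pi>) :: (nat \<Rightarrow>\<^sub>0 nat) \<Rightarrow> _)"
  have add: "mpermute \<pi> (P + Q) = mpermute \<pi> P + mpermute \<pi> Q" for P Q :: "'a mpol"
    unfolding mpermute_def by (rule map_key_plus[OF inj_map_key_permutes[OF \<pi>]])
  have zero: "mpermute \<pi> (0 :: 'a mpol) = 0"
    unfolding mpermute_def by (rule map_key_zero[OF inj_map_key_permutes[OF \<pi>]])
  have single: "mpermute \<pi> (Poly_Mapping.single m c) = Poly_Mapping.single (\<phi> m) c" for m and c :: 'a
  proof -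
    have "Poly_Mapping.map_key \<pi> (\<phi> m) = m"
      unfolding \<phi>_def
      by (simp add: map_key_compose permutes_inj[OF \<pi>] permutes_inj[OF permutes_inv[OF \<pi>]]
          permutes_inv_o[OF \<pi>] id_def[symmetric] map_key_id[unfolded id_def[symmetric]])
    then show ?thesis
      unfolding mpermute_def using map_key_single[OF inj_map_key_permutes[OF \<pi>], of "\<phi> m" c] by simp
  qed
  have \<phi>_add: "\<phi> (a + b) = \<phi> a + \<phi> b" for a b
    unfolding \<phi>_def by (rule map_key_plus[OF permutes_inj[OF permutes_inv[OF \<pi>]]])
  have \<phi>_0: "\<phi> 0 = 0"
    unfolding \<phi>_def by (rule map_key_zero[OF permutes_inj[OF permutes_inv[OF \<pi>]]])
  have sum: "mpermute \<pi> (\<Sum>i\<in>I. f i) = (\<Sum>i\<in>I. mpermute \<pi> (f i))" for I and f :: "'b \<Rightarrow> 'a mpol"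
    by (induction I rule: infinite_finite_induct) (simp_all add: zero add)
  have decomp: "P = (\<Sum>m\<in>Poly_Mapping.keys P. Poly_Mapping.single m (Poly_Mapping.lookup P m))" for P :: "'a mpol"
    by (rule poly_mapping_eqI)
      (simp add: lookup_sum lookup_single when_def in_keys_iff)
  have image: "mpermute \<pi> P =
      (\<Sum>m\<in>Poly_Mapping.keys P. Poly_Mapping.single (\<phi> m) (Poly_Mapping.lookup P m))" for P :: "'a mpol"
    by (subst decomp[of P]) (simp only: sum single)
  have product: "P * Q = (\<Sum>a\<in>Poly_Mapping.keys P. \<Sum>b\<in>Poly_Mapping.keys Q.
      Poly_Mapping.single (a + b) (Poly_Mapping.lookup P a * Poly_Mapping.lookup Q b))" for P Q :: "'a mpol"
    by (subst decomp[of P], subst decomp[of Q]) (simp only: sum_product mult_single)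
  have mult: "mpermute \<pi> (P * Q) = mpermute \<pi> P * mpermute \<pi> Q" for P Q :: "'a mpol"
    unfolding product[of P Q] image[of P] image[of Q]
    by (simp only: sum_product mult_single sum single \<phi>_add)
  show ?thesis
    by standard (simp_all add: add mult zero single \<phi>_0 flip: single_one)
qed

lemma mpermute_mconst:
  assumes "\<pi> permutes A"
  shows "mpermute \<pi> (mconst c) = mconst c"
proof -
  have "Poly_Mapping.map_key \<pi> (0 :: nat \<Rightarrow>\<^sub>0 nat) = 0"
    by (rule map_key_zero[OF permutes_inj[OF assms]])
  then show ?thesis
    using map_key_single[OF inj_map_key_permutes[OF assms], of 0 c]
    by (simp only: mpermute_def mconst_def)
qed

section \<open>Full symmetry\<close>

text \<open>The permutation of the entries of \<open>bar l q z\<close> that a permutation of the \<open>z\<^sub>a\<close> induces.\<close>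
definition permute_blocks :: "nat \<Rightarrow> nat \<Rightarrow> (nat \<Rightarrow> nat) \<Rightarrow> nat \<Rightarrow> nat" where
  "permute_blocks l m \<pi> r = (if r < l * m then \<pi> (r div l) * l + r mod l else r)"

lemma permute_blocks_permutes:
  assumes "l \<ge> 1" and \<pi>: "\<pi> permutes {..<m}"
  shows "permute_blocks l m \<pi> permutes {0..<l * m}"
proof -
  have mod: "r mod l < l" for r
    using assms(1) by simp
  have div: "r div l < m" if "r < l * m" for r
    using that by (simp add: less_mult_imp_div_less mult.commute)
  have into: "permute_blocks l m \<rho> r < l * m" if "\<rho> permutes {..<m}" "r < l * m" for \<rho> r
    using index_mult_add_less[OF _ mod, of "\<rho> (r div l)" m r] permutes_in_image[OF that(1)] div[OF that(2)] that(2)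
    by (simp add: permute_blocks_def)
  have inverse: "permute_blocks l m \<rho>' (permute_blocks l m \<rho> r) = r"
    if "\<rho> permutes {..<m}" "\<And>i. \<rho>' (\<rho> i) = i" "r < l * m" for \<rho> \<rho>' r
  proof -
    have "permute_blocks l m \<rho> r div l = \<rho> (r div l)" "permute_blocks l m \<rho> r mod l = r mod l"
      using that(3) assms(1) by (simp_all add: permute_blocks_def)
    then show ?thesis
      using into[OF that(1,3)] that(2) by (simp add: permute_blocks_def[of _ _ \<rho>'])
  qed
  show ?thesis
  proof (rule bij_imp_permutes)
    let ?\<pi>' = "inv_into UNIV \<pi>"
    have \<pi>': "?\<pi>' permutes {..<m}"
      by (rule permutes_inv[OF \<pi>])
    show "bij_betw (permute_blocks l m \<pi>) {0..<l * m} {0..<l * m}"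
      by (rule bij_betw_byWitness[of _ "permute_blocks l m ?\<pi>'"])
        (auto simp: into \<pi> \<pi>' inverse[OF \<pi> permutes_inverses(2)[OF \<pi>]]
          inverse[OF \<pi>' permutes_inverses(1)[OF \<pi>]])
  qed (simp add: permute_blocks_def)
qed

lemma rho_root: "rho l ^ (2 * l + 1) = 1"
  and rho_inj: "inj_on (\<lambda>e. rho l ^ e) {..<2 * l + 1}"
proof -
  let ?N = "2 * l + 1"
  have pow: "rho l ^ e = cis (2 * pi * real e / real ?N)" for e
  proof -
    have "rho l = cis (2 * pi / real ?N)"
      by (simp add: rho_def cis_conv_exp field_simps)
    then have "rho l ^ e = cis (real e * (2 * pi / real ?N))"
      by (simp only: DeMoivre)
    then show ?thesis
      by (simp add: mult_ac)
  qed
  have "bij_betw (\<lambda>k. cis (2 * pi * real k / real ?N)) {..<?N} {z. z ^ ?N = 1}"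
    by (rule bij_betw_roots_unity) simp
  then show "inj_on (\<lambda>e. rho l ^ e) {..<?N}"
    by (simp only: pow bij_betw_def)
  show "rho l ^ ?N = 1"
  proof -
    have "real ?N \<noteq> 0"
      by simp
    from nonzero_mult_div_cancel_right[OF this, of "2 * pi"] show ?thesis
      by (simp only: pow cis_2pi)
  qed
qed

theorem corollary4p3:
  fixes n l :: nat
  assumes "n \<ge> 1" and "l \<ge> 1"
  shows "\<exists>P :: complex mpol.
    Z_rat n l (rho l) = to_fract P \<and> mvars P \<subseteq> {..<2 * n} \<and> msymmetric {..<2 * n} P"
proof -
  let ?m = "l * (2 * n)"
  define q where "q = rho l"
  interpret const: comm_ring_hom "mconst :: complex \<Rightarrow> complex mpol"
    by (rule comm_ring_hom_mconst)
  interpret frac: comm_ring_hom "to_fract :: complex mpol \<Rightarrow> _"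
    by standard simp_all
  define \<phi> where "\<phi> c = to_fract (mconst c :: complex mpol)" for c
  interpret \<phi>: comm_ring_hom \<phi>
    by standard (simp_all add: \<phi>_def const.hom_add const.hom_mult)
  define z where "z a = to_fract (mvar a :: complex mpol)" for a
  have q_root: "q ^ (2 * l + 1) = 1" and q_inj: "inj_on (\<lambda>e. q ^ e) {..<2 * l + 1}"
    unfolding q_def by (rule rho_root, rule rho_inj)
  have q_nonzero: "q \<noteq> 0"
    using q_root by auto
  interpret generic_spectral_parameters n l "\<phi> q" z
  proof
    show "\<phi> q ^ (2 * l + 1) = 1"
      unfolding \<phi>.hom_power[symmetric] q_root by (rule \<phi>.hom_one)
    show "inj_on (\<lambda>(a, e). \<phi> q ^ e * z a) ({..<2 * n} \<times> {..<2 * l + 1})"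
    proof (rule inj_onI, clarify)
      fix a e b f
      assume ef: "e < 2 * l + 1" "f < 2 * l + 1" and eq: "\<phi> q ^ e * z a = \<phi> q ^ f * z b"
      have "mconst (q ^ e) * mvar a = (mconst (q ^ f) * mvar b :: complex mpol)"
        using eq by (simp only: z_def \<phi>_def to_fract_eq_iff flip: const.hom_power frac.hom_power to_fract_mult)
      then have "q ^ e = q ^ f \<and> a = b"
        by (subst (asm) mconst_mult_mvar_eq_iff) (simp_all add: q_nonzero)
      then show "a = b \<and> e = f"
        using ef inj_onD[OF q_inj, of e f] by simp
    qed
  qed fact+
  define U where "U r = mconst (q ^ (2 * (r mod l))) * (mvar (r div l) :: complex mpol)" for r
  define S where "S = alternant_quotient ?m (expo l) U"
  have MM: "M + M = ?m"
    by simp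
  have U: "to_fract (U r) = u r" for r
    by (simp add: U_def bar_def z_def \<phi>_def const.hom_power frac.hom_power)
  have nv: "to_fract (newton_vandermonde ?m U) = newton_vandermonde ?m u"
    by (simp add: newton_vandermonde_def frac.hom_prod U)
  have nv_square: "(newton_vandermonde ?m u)\<^sup>2 = (vandermonde ?m u)\<^sup>2"
    by (rule newton_vandermonde_square)
  have vand: "vandermonde ?m u \<noteq> 0"
    using vandermonde_nonzero unfolding MM .
  have det: "det alternant_mat = newton_vandermonde ?m u * to_fract S"
  proof -
    have "alternant_mat = map_mat to_fract (mat ?m ?m (\<lambda>(r, c). U r ^ expo l c))"
      unfolding alternant_mat_def MM by (rule eq_matI) (auto simp: frac.hom_power U)
    then show ?thesis
      by (simp only: frac.hom_det det_alternant to_fract_mult nv S_def)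
  qed
  obtain \<epsilon> where \<epsilon>: "\<epsilon> \<in> {1, -1}" and square: "(\<phi> q - \<phi> q ^ (2 * l)) ^ (2 * M) *
      (partition_fn n l (\<phi> q) z (\<lambda>j. z (n + j)) * vandermonde (M + M) u)\<^sup>2 =
    \<epsilon> * (\<Prod>d<2 * l * n. \<phi> q ^ (d mod (2 * l) + 1) - \<phi> q ^ (2 * l - d mod (2 * l))) * (det alternant_mat)\<^sup>2"
    using partition_fn_square by blast
  \<comment> \<open>The sign and the constants of \<open>partition_fn_square\<close> are images of complex numbers under
    \<open>\<phi>\<close>.\<close>
  define \<epsilon>' :: complex where "\<epsilon>' = (if \<epsilon> = 1 then 1 else - 1)"
  define \<gamma> where "\<gamma> = (q - q ^ (2 * l)) ^ (2 * M)"
  define \<kappa> where "\<kappa> = \<epsilon>' * (\<Prod>d<2 * l * n. q ^ (d mod (2 * l) + 1) - q ^ (2 * l - d mod (2 * l)))"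
  have "q \<noteq> q ^ (2 * l)"
    using q_neq_inverse by (auto simp flip: \<phi>.hom_power)
  then have \<gamma>: "\<gamma> \<noteq> 0"
    by (simp add: \<gamma>_def)
  have Z: "Z_rat n l (rho l) = partition_fn n l (\<phi> q) z (\<lambda>j. z (n + j))"
    by (simp only: Z_rat_def \<phi>_def q_def z_def[abs_def])
  have "\<phi> \<gamma> * (Z_rat n l (rho l))\<^sup>2 * (vandermonde ?m u)\<^sup>2 = \<phi> \<kappa> * (to_fract S)\<^sup>2 * (vandermonde ?m u)\<^sup>2"
  proof -
    have "\<phi> \<epsilon>' = \<epsilon>"
      using \<epsilon> by (auto simp: \<epsilon>'_def \<phi>.hom_uminus)
    then have "\<phi> \<kappa> = \<epsilon> * (\<Prod>d<2 * l * n. \<phi> q ^ (d mod (2 * l) + 1) - \<phi> q ^ (2 * l - d mod (2 * l)))"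
      by (simp only: \<kappa>_def \<phi>.hom_mult \<phi>.hom_prod \<phi>.hom_minus \<phi>.hom_power)
    moreover have "\<phi> \<gamma> = (\<phi> q - \<phi> q ^ (2 * l)) ^ (2 * M)"
      by (simp only: \<gamma>_def \<phi>.hom_minus \<phi>.hom_power)
    ultimately show ?thesis
      using square unfolding Z MM det power_mult_distrib nv_square
      by (simp only: mult_ac)
  qed
  then have "\<phi> \<gamma> * (Z_rat n l (rho l))\<^sup>2 = \<phi> \<kappa> * (to_fract S)\<^sup>2"
    using vand by simp
  \<comment> \<open>A square root of the constant exists in the coefficient field, so the identity of squares
    determines the partition function up to sign; \<open>c'\<close> absorbs this sign.\<close>
  define c where "c = csqrt (\<kappa> / \<gamma>)"
  have "\<phi> \<gamma> * (Z_rat n l (rho l))\<^sup>2 = \<phi> \<gamma> * (\<phi> c * to_fract S)\<^sup>2"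
  proof -
    have "\<kappa> = \<gamma> * c\<^sup>2"
      using \<gamma> by (simp add: c_def)
    then show ?thesis
      using \<open>\<phi> \<gamma> * _ = _\<close> by (simp only: \<phi>.hom_mult \<phi>.hom_power power_mult_distrib mult.assoc)
  qed
  moreover have "\<phi> \<gamma> \<noteq> 0"
    using \<gamma> by (auto simp: \<phi>_def mconst_def dest: arg_cong[where f = "\<lambda>P. Poly_Mapping.lookup P 0"])
  ultimately have "(Z_rat n l (rho l))\<^sup>2 = (\<phi> c * to_fract S)\<^sup>2"
    by simp
  then obtain c' where c': "Z_rat n l (rho l) = \<phi> c' * to_fract S"
    unfolding power2_eq_iff by (metis \<phi>.hom_uminus mult_minus_left)
  have "Z_rat n l (rho l) = to_fract (mconst c' * S)"
    unfolding c' \<phi>_def by (rule to_fract_mult[symmetric])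
  moreover have "mvars (mconst c' * S) \<subseteq> {..<2 * n}"
  proof -
    have "mvars (U r) \<subseteq> {..<2 * n}" if "r < ?m" for r
    proof -
      have "r div l < 2 * n"
        using that by (simp add: less_mult_imp_div_less mult.commute)
      then show ?thesis
        unfolding U_def by (intro order.trans[OF mvars_mult]) (simp add: mvars_mconst mvars_mvar)
    qed
    then have "mvars S \<subseteq> {..<2 * n}"
      unfolding S_def by (rule mvars_alternant_quotient)
    then show ?thesis
      by (intro order.trans[OF mvars_mult]) (simp add: mvars_mconst)
  qed
  moreover have "msymmetric {..<2 * n} (mconst c' * S)"
    unfolding msymmetric_def
  proof (intro allI impI)
    fix \<pi> assume \<pi>: "\<pi> permutes {..<2 * n}"
    interpret perm: comm_ring_hom "mpermute \<pi> :: complex mpol \<Rightarrow> _"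
      by (rule comm_ring_hom_mpermute[OF \<pi>])
    have mpermute_mconst: "mpermute \<pi> (mconst a) = mconst a" for a :: complex
      by (rule mpermute_mconst[OF \<pi>])
    have "mpermute \<pi> S = S"
      unfolding S_def
    proof (rule alternant_quotient_invariant[OF perm.comm_ring_hom_axioms])
      show "permute_blocks l (2 * n) \<pi> permutes {0..<?m}"
        by (rule permute_blocks_permutes[OF assms(2) \<pi>])
      show "mpermute \<pi> (U r) = U (permute_blocks l (2 * n) \<pi> r)" if "r < ?m" for r
        using that assms(2)
        by (simp add: U_def perm.hom_mult mpermute_mconst mpermute_mvar[OF \<pi>] permute_blocks_def)
      show "newton_vandermonde ?m U \<noteq> 0"
        using vand nv nv_square by auto
    qed
    then show "mpermute \<pi> (mconst c' * S) = mconst c' * S"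
      by (simp only: perm.hom_mult mpermute_mconst)
  qed
  ultimately show ?thesis
    by blast
qed

end
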